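(* Let $(\mathcal{H},[\cdot,\cdot])$ be a Krein space with fundamental symmetry $J$. If $\mathcal{F}=\{f_i\}_{i\in I}$ is a $J$-frame for $\mathcal{H}$ with $J$-frame operator $S$, then $\mathcal{G}=\{S^{-1}f_i\}_{i\in I}$ is also a $J$-frame for $\mathcal{H}$.
   Context: Krein space setting: $(\mathcal{H},[\cdot,\cdot])$ is a complex separable Krein space with a fixed fundamental decomposition $\mathcal{H}=\mathcal{H}_+\dotplus\mathcal{H}_-$ (the summands are $[\cdot,\cdot]$-orthogonal and $(\mathcal{H}_\pm,\pm[\cdot,\cdot])$ are Hilbert spaces). $\langle\cdot,\cdot\rangle$ is the inner product making $\mathcal{H}$ the orthogonal direct sum of these Hilbert spaces, $\|\cdot\|$ its norm, and the fundamental symmetry $J$ (a selfadjoint unitary) satisfies $[x,y]=\langle Jx,y\rangle$. A subspace $\mathcal{S}$ is uniformly $J$-positive (resp. uniformly $J$-negative) if there is $\alpha>0$ with $[x,x]\ge\alpha\|x\|^2$ (resp. $[x,x]\le-\alpha\|x\|^2$) for all $x\in\mathcal{S}$. "Maximal" means maximal with respect to inclusion among such subspaces. A Bessel family is a family $\mathcal{F}=\{f_i\}_{i\in I}$ in $\mathcal{H}$ with $\sum_i|\langle f,f_i\rangle|^2\le B\|f\|^2$ for all $f$ and some $B<\infty$. Its synthesis operator is the bounded operator $T:\ell_2(I)\to\mathcal{H}$, $Te_i=f_i$, with $\{e_i\}$ the standard orthonormal basis. Let $I_+=\{i:[f_i,f_i]\ge0\}$, $I_-=\{i:[f_i,f_i]<0\}$,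 $P_\pm$ the orthogonal projection of $\ell_2(I)$ onto $\ell_2(I_\pm)$, and $T_\pm=TP_\pm$. The Bessel family $\mathcal{F}$ is a $J$-frame for $\mathcal{H}$ if the range $R(T_+)$ is a maximal uniformly $J$-positive subspace and $R(T_-)$ is a maximal uniformly $J$-negative subspace of $\mathcal{H}$. The $J$-frame operator of a $J$-frame $\mathcal{F}$ is the bounded operator $S:\mathcal{H}\to\mathcal{H}$, $Sf=\sum_{i\in I}\sigma_i[f,f_i]f_i$ with $\sigma_i=\mathrm{sgn}([f_i,f_i])$; it is invertible for every $J$-frame. *)

theory Defs
  imports "HOL-Analysis.Analysis"
begin

section \<open>Krein spaces with a fixed fundamental decomposition\<close>

text \<open>
  The Krein space is the whole type \<open>'a\<close>. The complex scalar multiplication \<open>scale\<close> extends the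
  real one of the type, and by \<open>norm_decomp\<close> the norm of the type is the norm of the Hilbert space
  orthogonal direct sum of \<open>(Hp, form)\<close> and \<open>(Hm, -form)\<close>. Consequently \<open>complete Hp\<close> and
  \<open>complete Hm\<close> refer to the norms induced by \<open>form\<close> and \<open>-form\<close>. The form is linear in the first
  and conjugate-linear in the second argument.
\<close>

locale krein_space = cvs: vector_space scale
  for scale :: "complex \<Rightarrow> 'a::banach \<Rightarrow> 'a" (infixr \<open>*\<^sub>C\<close> 75) +
  fixes form :: "'a \<Rightarrow> 'a \<Rightarrow> complex"
    and Hp Hm :: "'a set"
  assumes scale_of_real: "complex_of_real r *\<^sub>C x = r *\<^sub>R x"
    and form_add_left: "form (x + y) z = form x z + form y z"
    and form_scale_left: "form (c *\<^sub>C x) y = c * form x y"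
    and form_hermitian: "form y x = cnj (form x y)"
    and subspace_Hp: "cvs.subspace Hp"
    and subspace_Hm: "cvs.subspace Hm"
    and Hp_Int_Hm: "Hp \<inter> Hm = {0}"
    and Hp_plus_Hm: "\<exists>u\<in>Hp. \<exists>v\<in>Hm. x = u + v"
    and Hp_orth_Hm: "u \<in> Hp \<Longrightarrow> v \<in> Hm \<Longrightarrow> form u v = 0"
    and form_pos: "u \<in> Hp \<Longrightarrow> u \<noteq> 0 \<Longrightarrow> 0 < Re (form u u)"
    and form_neg: "v \<in> Hm \<Longrightarrow> v \<noteq> 0 \<Longrightarrow> Re (form v v) < 0"
    and norm_decomp: "u \<in> Hp \<Longrightarrow> v \<in> Hm \<Longrightarrow> (norm (u + v))\<^sup>2 = Re (form u u) - Re (form v v)"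
    and complete_Hp: "complete Hp"
    and complete_Hm: "complete Hm"
    and separable: "separable_space (euclidean :: 'a topology)"
begin

definition proj_plus :: "'a \<Rightarrow> 'a"
  where "proj_plus x = (THE u. u \<in> Hp \<and> x - u \<in> Hm)"

definition proj_minus :: "'a \<Rightarrow> 'a"
  where "proj_minus x = (THE v. v \<in> Hm \<and> x - v \<in> Hp)"

definition J :: "'a \<Rightarrow> 'a"
  where "J x = proj_plus x - proj_minus x"

definition ip :: "'a \<Rightarrow> 'a \<Rightarrow> complex"
  where "ip x y = form (proj_plus x) (proj_plus y) - form (proj_minus x) (proj_minus y)"

text \<open>By hermiticity \<open>form x x\<close> is real, so inequalities for it are stated with \<open>Re\<close>.\<close>

definition uniformly_J_positive :: "'a set \<Rightarrow> bool"
  where "uniformly_J_positive M \<longleftrightarrow>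
    cvs.subspace M \<and> (\<exists>\<alpha>>0. \<forall>x\<in>M. Re (form x x) \<ge> \<alpha> * (norm x)\<^sup>2)"

definition uniformly_J_negative :: "'a set \<Rightarrow> bool"
  where "uniformly_J_negative M \<longleftrightarrow>
    cvs.subspace M \<and> (\<exists>\<alpha>>0. \<forall>x\<in>M. Re (form x x) \<le> - \<alpha> * (norm x)\<^sup>2)"

definition maximal_uniformly_J_positive :: "'a set \<Rightarrow> bool"
  where "maximal_uniformly_J_positive M \<longleftrightarrow>
    uniformly_J_positive M \<and> (\<forall>M'. uniformly_J_positive M' \<and> M \<subseteq> M' \<longrightarrow> M' = M)"

definition maximal_uniformly_J_negative :: "'a set \<Rightarrow> bool"
  where "maximal_uniformly_J_negative M \<longleftrightarrow>
    uniformly_J_negative M \<and> (\<forall>M'. uniformly_J_negative M' \<and> M \<subseteq> M' \<longrightarrow> M' = M)"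

end


section \<open>J-frames\<close>

text \<open>Elements of \<open>ell2 I\<close> are functions on the whole index type that vanish outside \<open>I\<close>.\<close>

definition ell2 :: "'i set \<Rightarrow> ('i \<Rightarrow> complex) set"
  where "ell2 I = {c. (\<forall>i. i \<notin> I \<longrightarrow> c i = 0) \<and> (\<lambda>i. (cmod (c i))\<^sup>2) summable_on I}"

definition ell2_proj :: "'i set \<Rightarrow> ('i \<Rightarrow> complex) \<Rightarrow> 'i \<Rightarrow> complex"
  where "ell2_proj A c = (\<lambda>i. if i \<in> A then c i else 0)"

context krein_space
begin

definition bessel_family :: "'i set \<Rightarrow> ('i \<Rightarrow> 'a) \<Rightarrow> bool"
  where "bessel_family I f \<longleftrightarrow>
    (\<exists>B. \<forall>x. (\<lambda>i. (cmod (ip x (f i)))\<^sup>2) summable_on I \<and>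
             (\<Sum>\<^sub>\<infinity>i\<in>I. (cmod (ip x (f i)))\<^sup>2) \<le> B * (norm x)\<^sup>2)"

text \<open>
  For a Bessel family the series converges unconditionally in norm and defines the bounded linear
  operator on \<open>ell2 I\<close> that maps the standard basis vectors to the members of the family; see
  \<open>synthesis_summable\<close>, \<open>synthesis_bounded\<close>, \<open>synthesis_add\<close>, \<open>synthesis_scale\<close>,
  \<open>synthesis_basis\<close> below.
\<close>

definition synthesis :: "'i set \<Rightarrow> ('i \<Rightarrow> 'a) \<Rightarrow> ('i \<Rightarrow> complex) \<Rightarrow> 'a"
  where "synthesis I f c = (\<Sum>\<^sub>\<infinity>i\<in>I. c i *\<^sub>C f i)"

definition index_plus :: "'i set \<Rightarrow> ('i \<Rightarrow> 'a) \<Rightarrow> 'i set"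
  where "index_plus I f = {i \<in> I. Re (form (f i) (f i)) \<ge> 0}"

definition index_minus :: "'i set \<Rightarrow> ('i \<Rightarrow> 'a) \<Rightarrow> 'i set"
  where "index_minus I f = {i \<in> I. Re (form (f i) (f i)) < 0}"

definition synthesis_plus :: "'i set \<Rightarrow> ('i \<Rightarrow> 'a) \<Rightarrow> ('i \<Rightarrow> complex) \<Rightarrow> 'a"
  where "synthesis_plus I f = synthesis I f \<circ> ell2_proj (index_plus I f)"

definition synthesis_minus :: "'i set \<Rightarrow> ('i \<Rightarrow> 'a) \<Rightarrow> ('i \<Rightarrow> complex) \<Rightarrow> 'a"
  where "synthesis_minus I f = synthesis I f \<circ> ell2_proj (index_minus I f)"

definition J_frame :: "'i set \<Rightarrow> ('i \<Rightarrow> 'a) \<Rightarrow> bool"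
  where "J_frame I f \<longleftrightarrow>
    bessel_family I f \<and>
    maximal_uniformly_J_positive (synthesis_plus I f ` ell2 I) \<and>
    maximal_uniformly_J_negative (synthesis_minus I f ` ell2 I)"

definition J_frame_operator :: "'i set \<Rightarrow> ('i \<Rightarrow> 'a) \<Rightarrow> 'a \<Rightarrow> 'a"
  where "J_frame_operator I f x =
    (\<Sum>\<^sub>\<infinity>i\<in>I. (complex_of_real (sgn (Re (form (f i) (f i)))) * form x (f i)) *\<^sub>C f i)"

end


section \<open>Consistency of the definitions\<close>

context krein_space
begin

lemma form_add_right: "form x (y + z) = form x y + form x z"
  using form_add_left[of y z x] form_hermitian complex_cnj_add by metis

lemma form_scale_right: "form x (c *\<^sub>C y) = cnj c * form x y"
  using form_scale_left[of c y x] form_hermitian complex_cnj_mult by metis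

lemma form_minus_left: "form (- x) z = - form x z"
  using form_scale_left[of "-1" x z] by (simp add: cvs.scale_minus_left)

lemma form_minus_right: "form x (- z) = - form x z"
  using form_scale_right[of x "-1" z] by (simp add: cvs.scale_minus_left)

lemma form_diff_left: "form (x - y) z = form x z - form y z"
  using form_add_left[of x "- y" z] by (simp add: form_minus_left)

lemma form_diff_right: "form x (y - z) = form x y - form x z"
  using form_add_right[of x y "- z"] by (simp add: form_minus_right)

lemma Hm_orth_Hp: "v \<in> Hm \<Longrightarrow> u \<in> Hp \<Longrightarrow> form v u = 0"
  using Hp_orth_Hm form_hermitian complex_cnj_zero by metis

lemma decomp_unique:
  assumes "u \<in> Hp" "v \<in> Hm" "u' \<in> Hp" "v' \<in> Hm" "u + v = u' + v'"
  shows "u = u'" "v = v'"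
proof -
  have "u - u' = v' - v"
    using assms(5) by (simp add: algebra_simps)
  moreover have "u - u' \<in> Hp" "v' - v \<in> Hm"
    using assms subspace_Hp subspace_Hm by (auto intro: cvs.subspace_diff)
  ultimately have "u - u' \<in> Hp \<inter> Hm" by auto
  then have "u - u' = 0" using Hp_Int_Hm by blast
  then show "u = u'" "v = v'" using assms(5) by auto
qed

lemma proj_eq:
  assumes "u \<in> Hp" "v \<in> Hm"
  shows "proj_plus (u + v) = u" "proj_minus (u + v) = v"
proof -
  show "proj_plus (u + v) = u"
    unfolding proj_plus_def
  proof (rule the_equality)
    show "u \<in> Hp \<and> u + v - u \<in> Hm" using assms by simp
    show "w = u" if "w \<in> Hp \<and> u + v - w \<in> Hm" for w
      using decomp_unique(1)[of w "u + v - w" u v] that assms by simp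
  qed
  show "proj_minus (u + v) = v"
    unfolding proj_minus_def
  proof (rule the_equality)
    show "v \<in> Hm \<and> u + v - v \<in> Hp" using assms by simp
    show "w = v" if "w \<in> Hm \<and> u + v - w \<in> Hp" for w
      using decomp_unique(2)[of "u + v - w" w u v] that assms by simp
  qed
qed

lemma proj_plus_in: "proj_plus x \<in> Hp"
  and proj_minus_in: "proj_minus x \<in> Hm"
  and proj_sum: "proj_plus x + proj_minus x = x"
proof -
  obtain u v where "u \<in> Hp" "v \<in> Hm" "x = u + v"
    using Hp_plus_Hm by blast
  then show "proj_plus x \<in> Hp" "proj_minus x \<in> Hm" "proj_plus x + proj_minus x = x"
    using proj_eq by auto
qed

lemma proj_add:
  "proj_plus (x + y) = proj_plus x + proj_plus y"
  "proj_minus (x + y) = proj_minus x + proj_minus y"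
proof -
  have "x + y = (proj_plus x + proj_plus y) + (proj_minus x + proj_minus y)"
    using proj_sum[of x] proj_sum[of y] by (metis add.assoc add.left_commute)
  moreover have "proj_plus x + proj_plus y \<in> Hp" "proj_minus x + proj_minus y \<in> Hm"
    using proj_plus_in proj_minus_in subspace_Hp subspace_Hm by (auto intro: cvs.subspace_add)
  ultimately show
    "proj_plus (x + y) = proj_plus x + proj_plus y"
    "proj_minus (x + y) = proj_minus x + proj_minus y"
    using proj_eq by metis+
qed

lemma proj_scale:
  "proj_plus (c *\<^sub>C x) = c *\<^sub>C proj_plus x"
  "proj_minus (c *\<^sub>C x) = c *\<^sub>C proj_minus x"
proof -
  have "c *\<^sub>C x = c *\<^sub>C proj_plus x + c *\<^sub>C proj_minus x"
    using proj_sum[of x] cvs.scale_right_distrib by metis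
  moreover have "c *\<^sub>C proj_plus x \<in> Hp" "c *\<^sub>C proj_minus x \<in> Hm"
    using proj_plus_in proj_minus_in subspace_Hp subspace_Hm by (auto intro: cvs.subspace_scale)
  ultimately show
    "proj_plus (c *\<^sub>C x) = c *\<^sub>C proj_plus x"
    "proj_minus (c *\<^sub>C x) = c *\<^sub>C proj_minus x"
    using proj_eq by metis+
qed

lemma ip_add_left: "ip (x + y) z = ip x z + ip y z"
  by (simp add: ip_def proj_add form_add_left)

lemma ip_scale_left: "ip (c *\<^sub>C x) z = c * ip x z"
  by (simp add: ip_def proj_scale form_scale_left algebra_simps)

lemma ip_commute: "ip y x = cnj (ip x y)"
  unfolding ip_def using form_hermitian complex_cnj_diff by metis

lemma ip_self: "ip x x = complex_of_real ((norm x)\<^sup>2)"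
proof -
  have "Re (ip x x) = (norm x)\<^sup>2"
    using norm_decomp[OF proj_plus_in proj_minus_in, of x x] by (simp add: ip_def proj_sum)
  moreover have "Im (ip x x) = 0"
    using arg_cong[OF ip_commute[of x x], of Im] by simp
  ultimately show ?thesis by (simp add: complex_eq_iff)
qed

lemma form_eq_ip_J: "form x y = ip (J x) y"
proof -
  have m: "- proj_minus x \<in> Hm"
    using proj_minus_in subspace_Hm by (auto intro: cvs.subspace_neg)
  have "J x = proj_plus x + (- proj_minus x)" by (simp add: J_def)
  then have "proj_plus (J x) = proj_plus x" "proj_minus (J x) = - proj_minus x"
    using proj_eq[OF proj_plus_in m] by simp_all
  then have "ip (J x) y = form (proj_plus x) (proj_plus y) + form (proj_minus x) (proj_minus y)"
    by (simp add: ip_def form_minus_left)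
  also have "\<dots> = form (proj_plus x + proj_minus x) (proj_plus y + proj_minus y)"
    by (simp add: form_add_left form_add_right Hp_orth_Hm Hm_orth_Hp proj_plus_in proj_minus_in)
  finally show ?thesis by (simp add: proj_sum)
qed

lemma J_J: "J (J x) = x"
proof -
  have m: "- proj_minus x \<in> Hm"
    using proj_minus_in subspace_Hm by (auto intro: cvs.subspace_neg)
  have "J x = proj_plus x + (- proj_minus x)" by (simp add: J_def)
  then have "proj_plus (J x) = proj_plus x" "proj_minus (J x) = - proj_minus x"
    using proj_eq[OF proj_plus_in m] by simp_all
  then show ?thesis
    by (simp add: J_def[of "J x"] proj_sum)
qed

lemma J_selfadjoint: "ip (J x) y = ip x (J y)"
  using form_eq_ip_J form_hermitian ip_commute by metis

lemma norm_scale: "norm (c *\<^sub>C x) = cmod c * norm x"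
proof -
  have "complex_of_real ((norm (c *\<^sub>C x))\<^sup>2) = c * cnj c * complex_of_real ((norm x)\<^sup>2)"
    using ip_scale_left[of c x "c *\<^sub>C x"] ip_scale_left[of c x x] ip_commute[of x "c *\<^sub>C x"]
    by (simp add: ip_self ip_commute[of x "c *\<^sub>C x"] del: of_real_power)
  also have "\<dots> = complex_of_real ((cmod c * norm x)\<^sup>2)"
    by (simp only: complex_norm_square[symmetric] power_mult_distrib of_real_mult)
  finally have "(norm (c *\<^sub>C x))\<^sup>2 = (cmod c * norm x)\<^sup>2"
    using of_real_eq_iff by blast
  then show ?thesis by simp
qed

lemma bounded_linear_scale: "bounded_linear (\<lambda>x. c *\<^sub>C x)"
proof (rule bounded_linear_intro)
  show "c *\<^sub>C (x + y) = c *\<^sub>C x + c *\<^sub>C y" for x y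
    by (rule cvs.scale_right_distrib)
  show "c *\<^sub>C (r *\<^sub>R x) = r *\<^sub>R (c *\<^sub>C x)" for r x
    by (simp only: scale_of_real[symmetric] cvs.scale_left_commute)
  show "norm (c *\<^sub>C x) \<le> norm x * cmod c" for x
    by (simp add: norm_scale)
qed

lemma ip_sum_left: "ip (sum g F) z = (\<Sum>i\<in>F. ip (g i) z)"
proof -
  have "ip 0 z = 0" using ip_scale_left[of 0 0 z] by simp
  then show ?thesis
    by (induction F rule: infinite_finite_induct) (simp_all add: ip_add_left)
qed

lemma bessel_family_finite_bound:
  assumes "bessel_family I f"
  obtains B where "0 \<le> B"
    "\<And>F c. finite F \<Longrightarrow> F \<subseteq> I \<Longrightarrow>
      (norm (\<Sum>i\<in>F. c i *\<^sub>C f i))\<^sup>2 \<le> B * (\<Sum>i\<in>F. (cmod (c i))\<^sup>2)"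
proof -
  obtain B where B: "\<And>x. (\<lambda>i. (cmod (ip x (f i)))\<^sup>2) summable_on I"
    "\<And>x. (\<Sum>\<^sub>\<infinity>i\<in>I. (cmod (ip x (f i)))\<^sup>2) \<le> B * (norm x)\<^sup>2"
    using assms unfolding bessel_family_def by blast
  define B' where "B' = max B 0"
  have "(norm (\<Sum>i\<in>F. c i *\<^sub>C f i))\<^sup>2 \<le> B' * (\<Sum>i\<in>F. (cmod (c i))\<^sup>2)"
    if F: "finite F" "F \<subseteq> I" for F and c :: "'b \<Rightarrow> complex"
  proof -
    define y where "y = (\<Sum>i\<in>F. c i *\<^sub>C f i)"
    have "(\<Sum>i\<in>F. (cmod (ip y (f i)))\<^sup>2) \<le> (\<Sum>\<^sub>\<infinity>i\<in>I. (cmod (ip y (f i)))\<^sup>2)"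
      by (rule finite_sum_le_infsum) (use B F in auto)
    also have "\<dots> \<le> B * (norm y)\<^sup>2" by (rule B)
    also have "\<dots> \<le> B' * (norm y)\<^sup>2"
      by (intro mult_right_mono) (auto simp: B'_def)
    finally have ub: "(\<Sum>i\<in>F. (cmod (ip y (f i)))\<^sup>2) \<le> B' * (norm y)\<^sup>2" .
    have "(norm y)\<^sup>2 = cmod (ip y y)" by (simp add: ip_self norm_power)
    also have "ip y y = (\<Sum>i\<in>F. c i * ip (f i) y)"
      by (subst (1) y_def) (simp add: ip_sum_left ip_scale_left)
    also have "cmod \<dots> \<le> (\<Sum>i\<in>F. cmod (c i * ip (f i) y))" by (rule norm_sum)
    also have "\<dots> = (\<Sum>i\<in>F. cmod (c i) * cmod (ip y (f i)))"
      by (intro sum.cong refl) (simp add: norm_mult ip_commute[of _ y])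
    finally have "((norm y)\<^sup>2)\<^sup>2 \<le> (\<Sum>i\<in>F. cmod (c i) * cmod (ip y (f i)))\<^sup>2"
      by (intro power_mono) auto
    also have "\<dots> \<le> (\<Sum>i\<in>F. (cmod (c i))\<^sup>2) * (\<Sum>i\<in>F. (cmod (ip y (f i)))\<^sup>2)"
      by (rule Cauchy_Schwarz_ineq_sum)
    also have "\<dots> \<le> (\<Sum>i\<in>F. (cmod (c i))\<^sup>2) * (B' * (norm y)\<^sup>2)"
      by (intro mult_left_mono ub sum_nonneg) auto
    finally have *: "(norm y)\<^sup>2 * (norm y)\<^sup>2 \<le> (B' * (\<Sum>i\<in>F. (cmod (c i))\<^sup>2)) * (norm y)\<^sup>2"
      by (simp add: power2_eq_square algebra_simps)
    show ?thesis
    proof (cases "norm y = 0")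
      case True
      then show ?thesis
        by (simp add: y_def[symmetric] B'_def sum_nonneg)
    next
      case False
      then have "0 < (norm y)\<^sup>2" by simp
      with * have "(norm y)\<^sup>2 \<le> B' * (\<Sum>i\<in>F. (cmod (c i))\<^sup>2)"
        by (rule mult_right_le_imp_le)
      then show ?thesis by (simp only: y_def)
    qed
  qed
  moreover have "0 \<le> B'" by (simp add: B'_def)
  ultimately show ?thesis using that by blast
qed

lemma synthesis_summable:
  assumes "bessel_family I f" "c \<in> ell2 I"
  shows "(\<lambda>i. c i *\<^sub>C f i) summable_on I"
proof -
  obtain B where B: "0 \<le> B"
    "\<And>F. finite F \<Longrightarrow> F \<subseteq> I \<Longrightarrow>
      (norm (\<Sum>i\<in>F. c i *\<^sub>C f i))\<^sup>2 \<le> B * (\<Sum>i\<in>F. (cmod (c i))\<^sup>2)"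
    using bessel_family_finite_bound[OF assms(1)] by metis
  define a where "a i = (cmod (c i))\<^sup>2" for i
  define s where "s = (\<Sum>\<^sub>\<infinity>i\<in>I. a i)"
  have a: "a summable_on I" "\<And>i. 0 \<le> a i"
    using assms(2) unfolding ell2_def a_def[abs_def] by simp_all
  have lim: "(sum a \<longlongrightarrow> s) (finite_subsets_at_top I)"
    unfolding s_def by (rule infsum_tendsto[OF a(1)])
  let ?g = "\<lambda>i. c i *\<^sub>C f i"
  have "cauchy_filter (filtermap (sum ?g) (finite_subsets_at_top I))"
    unfolding cauchy_filter_metric_filtermap
  proof (intro allI impI)
    fix e :: real
    assume e: "0 < e"
    define d where "d = e\<^sup>2 / (4 * (B + 1))"
    have d: "0 < d" using e B(1) by (simp add: d_def)
    have "\<exists>X. finite X \<and> X \<subseteq> I \<and>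
        (\<forall>F. finite F \<and> X \<subseteq> F \<and> F \<subseteq> I \<longrightarrow> dist (sum a F) s < d)"
      using tendstoD[OF lim d] by (simp only: eventually_finite_subsets_at_top)
    then obtain F0 where F0: "finite F0" "F0 \<subseteq> I"
      "\<And>F. finite F \<Longrightarrow> F0 \<subseteq> F \<Longrightarrow> F \<subseteq> I \<Longrightarrow> dist (sum a F) s < d"
      by auto
    have near: "norm (sum ?g F - sum ?g F0) < e / 2" if F: "finite F" "F0 \<subseteq> F" "F \<subseteq> I" for F
    proof -
      have le: "sum a F \<le> s"
        unfolding s_def by (rule finite_sum_le_infsum) (use a F in auto)
      have "sum a (F - F0) = sum a F - sum a F0"
        using F by (simp add: sum_diff)
      also have "\<dots> < d"
        using F0(3)[of F0] F0(1,2) le by (simp add: dist_real_def)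
      finally have sm: "sum a (F - F0) < d" .
      have "(norm (sum ?g F - sum ?g F0))\<^sup>2 = (norm (sum ?g (F - F0)))\<^sup>2"
        using F by (simp add: sum_diff)
      also have "\<dots> \<le> B * sum a (F - F0)"
        using B(2)[of "F - F0"] F by (auto simp: a_def)
      also have "\<dots> \<le> (B + 1) * sum a (F - F0)"
        by (intro mult_right_mono sum_nonneg) (use a in auto)
      also have "\<dots> < (B + 1) * d"
        using sm B(1) by (intro mult_strict_left_mono) auto
      also have "\<dots> = (e / 2)\<^sup>2"
      proof -
        have "B + 1 \<noteq> 0" using B(1) by linarith
        then show ?thesis by (simp add: d_def power_divide divide_eq_eq algebra_simps)
      qed
      finally show ?thesis
        using e by (meson less_eq_real_def half_gt_zero power2_less_imp_less)
    qed
    show "\<exists>P. eventually P (finite_subsets_at_top I) \<and>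
      (\<forall>x y. P x \<and> P y \<longrightarrow> dist (sum ?g x) (sum ?g y) < e)"
    proof (intro exI conjI allI impI)
      show "eventually (\<lambda>F. finite F \<and> F0 \<subseteq> F \<and> F \<subseteq> I) (finite_subsets_at_top I)"
        unfolding eventually_finite_subsets_at_top using F0 by blast
      fix F G
      assume *: "(finite F \<and> F0 \<subseteq> F \<and> F \<subseteq> I) \<and> (finite G \<and> F0 \<subseteq> G \<and> G \<subseteq> I)"
      have "dist (sum ?g F) (sum ?g F0) < e / 2" "dist (sum ?g G) (sum ?g F0) < e / 2"
        using near[of F] near[of G] * by (auto simp: dist_norm)
      then show "dist (sum ?g F) (sum ?g G) < e"
        using dist_triangle_half_r[of "sum ?g F0" "sum ?g F" e "sum ?g G"]
        by (simp add: dist_commute)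
    qed
  qed
  then have "convergent_filter (filtermap (sum ?g) (finite_subsets_at_top I))"
    by (rule cauchy_filter_convergent)
  then show ?thesis
    unfolding summable_on_def has_sum_def filterlim_def convergent_filter_iff by blast
qed

lemma synthesis_bounded:
  assumes "bessel_family I f"
  shows "\<exists>K. \<forall>c\<in>ell2 I. norm (synthesis I f c) \<le> K * sqrt (\<Sum>\<^sub>\<infinity>i\<in>I. (cmod (c i))\<^sup>2)"
proof -
  obtain B where B: "0 \<le> B"
    "\<And>F c. finite F \<Longrightarrow> F \<subseteq> I \<Longrightarrow>
      (norm (\<Sum>i\<in>F. c i *\<^sub>C f i))\<^sup>2 \<le> B * (\<Sum>i\<in>F. (cmod (c i))\<^sup>2)"
    using bessel_family_finite_bound[OF assms] by metis
  have "norm (synthesis I f c) \<le> sqrt B * sqrt (\<Sum>\<^sub>\<infinity>i\<in>I. (cmod (c i))\<^sup>2)"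
    if c: "c \<in> ell2 I" for c
  proof (rule tendsto_upperbound)
    show "((\<lambda>F. norm (\<Sum>i\<in>F. c i *\<^sub>C f i)) \<longlongrightarrow> norm (synthesis I f c)) (finite_subsets_at_top I)"
      unfolding synthesis_def
      by (intro tendsto_norm infsum_tendsto synthesis_summable[OF assms c])
    show "\<forall>\<^sub>F F in finite_subsets_at_top I.
        norm (\<Sum>i\<in>F. c i *\<^sub>C f i) \<le> sqrt B * sqrt (\<Sum>\<^sub>\<infinity>i\<in>I. (cmod (c i))\<^sup>2)"
    proof (rule eventually_finite_subsets_at_top_weakI)
      fix F assume F: "finite F" "F \<subseteq> I"
      have "(norm (\<Sum>i\<in>F. c i *\<^sub>C f i))\<^sup>2 \<le> B * (\<Sum>i\<in>F. (cmod (c i))\<^sup>2)"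
        by (rule B(2)[OF F])
      also have "\<dots> \<le> B * (\<Sum>\<^sub>\<infinity>i\<in>I. (cmod (c i))\<^sup>2)"
        by (intro mult_left_mono finite_sum_le_infsum) (use c F B in \<open>auto simp: ell2_def\<close>)
      finally show "norm (\<Sum>i\<in>F. c i *\<^sub>C f i) \<le> sqrt B * sqrt (\<Sum>\<^sub>\<infinity>i\<in>I. (cmod (c i))\<^sup>2)"
        by (simp add: real_le_rsqrt real_sqrt_mult[symmetric])
    qed
  qed simp
  then show ?thesis by blast
qed

lemma synthesis_add:
  assumes "bessel_family I f" "c \<in> ell2 I" "d \<in> ell2 I"
  shows "synthesis I f (\<lambda>i. c i + d i) = synthesis I f c + synthesis I f d"
  unfolding synthesis_def cvs.scale_left_distrib
  by (intro infsum_add synthesis_summable assms)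

lemma synthesis_scale:
  assumes "bessel_family I f" "c \<in> ell2 I"
  shows "synthesis I f (\<lambda>i. z * c i) = z *\<^sub>C synthesis I f c"
proof -
  have "(\<Sum>\<^sub>\<infinity>i\<in>I. z *\<^sub>C (c i *\<^sub>C f i)) = z *\<^sub>C (\<Sum>\<^sub>\<infinity>i\<in>I. c i *\<^sub>C f i)"
    by (rule infsumI[OF has_sum_bounded_linear[OF bounded_linear_scale[of z]
            has_sum_infsum[OF synthesis_summable[OF assms]]]])
  then show ?thesis by (simp add: synthesis_def)
qed

lemma synthesis_basis:
  assumes "i \<in> I"
  shows "synthesis I f (\<lambda>j. if j = i then 1 else 0) = f i"
proof -
  have "synthesis I f (\<lambda>j. if j = i then 1 else 0) =
      (\<Sum>\<^sub>\<infinity>j\<in>{i}. (if j = i then 1 else 0) *\<^sub>C f j)"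
    unfolding synthesis_def by (rule infsum_cong_neutral) (use assms in auto)
  then show ?thesis by simp
qed

lemma J_frame_operator_summable:
  assumes "bessel_family I f"
  shows "(\<lambda>i. (complex_of_real (sgn (Re (form (f i) (f i)))) * form x (f i)) *\<^sub>C f i) summable_on I"
proof -
  define c where
    "c i = (if i \<in> I then complex_of_real (sgn (Re (form (f i) (f i)))) * form x (f i) else 0)" for i
  have "(\<lambda>i. (cmod (ip (J x) (f i)))\<^sup>2) summable_on I"
    using assms unfolding bessel_family_def by blast
  then have "(\<lambda>i. (cmod (c i))\<^sup>2) summable_on I"
    by (rule summable_on_comparison_test)
       (auto simp: c_def norm_mult form_eq_ip_J abs_sgn_eq)
  then have "c \<in> ell2 I" by (simp add: ell2_def c_def)
  from synthesis_summable[OF assms this] show ?thesis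
    by (rule summable_on_cong[THEN iffD1, rotated]) (simp add: c_def)
qed

end

end

theory Submission
  imports Defs
begin

text \<open>
  Let \<open>M\<^sub>+\<close> and \<open>M\<^sub>-\<close> be the ranges of \<open>T\<^sub>+\<close> and \<open>T\<^sub>-\<close>, and let \<open>N\<^sub>+\<close>, \<open>N\<^sub>-\<close> be the orthogonal companions
  (with respect to \<open>form\<close>) of \<open>M\<^sub>-\<close> and \<open>M\<^sub>+\<close>; they are again maximal uniformly definite. On \<open>N\<^sub>+\<close> the
  operator \<open>S\<close> is the sum over the nonnegative members only, and the hermitian form
  \<open>form (S x) y\<close> is coercive there, because \<open>T\<^sub>+\<close> maps onto the complete space \<open>M\<^sub>+\<close>. The Riesz
  representation for this form shows that \<open>S\<close> maps \<open>N\<^sub>+\<close> onto \<open>M\<^sub>+\<close> and that the preimages of the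
  nonnegative members form a Bessel family with synthesis range \<open>N\<^sub>+\<close>. The negative part follows by
  passing to the form \<open>-form\<close>, which exchanges \<open>Hp\<close> and \<open>Hm\<close>. Since \<open>N\<^sub>+\<close> and \<open>N\<^sub>-\<close> are definite, \<open>S\<inverse>\<close>
  preserves the signs of the members.
\<close>

section \<open>Riesz representation and uniform boundedness on a closed subspace\<close>

text \<open>The representing vector is the minimiser over \<open>M\<close> of the quadratic
  functional \<open>\<phi>\<close>. Coercivity bounds \<open>\<phi>\<close> below and makes
  minimising sequences Cauchy, and vanishing of the first variation at the minimum is the asserted
  identity.\<close>

lemma riesz_symmetric_form:
  fixes b :: "'a::banach \<Rightarrow> 'a \<Rightarrow> real"
  assumes b: "bounded_bilinear b" and sym: "\<And>x y. b x y = b y x"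
    and M: "subspace M" "closed M"
    and \<alpha>: "0 < \<alpha>" "\<And>x. x \<in> M \<Longrightarrow> \<alpha> * (norm x)\<^sup>2 \<le> b x x"
    and l: "bounded_linear l"
  obtains n where "n \<in> M" "\<And>m. m \<in> M \<Longrightarrow> b n m = l m"
proof -
  interpret b: bounded_bilinear b by (rule b)
  interpret l: bounded_linear l by (rule l)
  define \<phi> where "\<phi> m = b m m - 2 * l m" for m
  define d where "d = Inf (\<phi> ` M)"
  obtain K where K: "\<And>m. norm (l m) \<le> norm m * K" using l.bounded by blast
  \<comment> \<open>Completing the square in \<open>norm m\<close> balances the coercive quadratic
    term against the linear bound \<open>K\<close>.\<close>
  have lower: "- (K\<^sup>2 / \<alpha>) \<le> \<phi> m" if "m \<in> M" for m
  proof -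
    have "0 \<le> (\<alpha> * norm m - K)\<^sup>2 / \<alpha>" using \<alpha>(1) by simp
    also have "\<dots> = \<alpha> * (norm m)\<^sup>2 - 2 * (norm m * K) + K\<^sup>2 / \<alpha>"
      using \<alpha>(1) by (simp add: power2_diff power2_eq_square field_simps)
    also have "\<dots> \<le> \<phi> m + K\<^sup>2 / \<alpha>"
      using \<alpha>(2)[OF that] K[of m] by (simp add: \<phi>_def abs_le_iff)
    finally show ?thesis by simp
  qed
  have M0: "0 \<in> M" using M(1) by (rule subspace_0)
  have bdd: "bdd_below (\<phi> ` M)" using lower by (intro bdd_belowI2) auto
  have d_le: "d \<le> \<phi> m" if "m \<in> M" for m
    unfolding d_def using bdd that by (intro cInf_lower) auto
  have "\<exists>m\<in>M. \<phi> m < d + 1 / real (Suc k)" for k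
  proof -
    have "Inf (\<phi> ` M) < d + 1 / real (Suc k)" by (simp add: d_def)
    then show ?thesis using cInf_lessD[of "\<phi> ` M"] M0 by blast
  qed
  then obtain x where x: "\<And>k. x k \<in> M" "\<And>k. \<phi> (x k) < d + 1 / real (Suc k)" by metis
  \<comment> \<open>The contributions of \<open>l\<close> cancel. Since \<open>d\<close> bounds the
    value at the midpoint from below, two near-minimisers must be close to each other.\<close>
  have parallelogram: "b (u - v) (u - v) = 2 * \<phi> u + 2 * \<phi> v - 4 * \<phi> ((1/2) *\<^sub>R (u + v))" for u v
    unfolding \<phi>_def
    by (simp add: b.add_left b.add_right b.diff_left b.diff_right b.scaleR_left b.scaleR_right
        l.add l.scaleR algebra_simps)
  have close: "\<alpha> * (dist (x j) (x k))\<^sup>2 \<le> 2 / real (Suc j) + 2 / real (Suc k)" for j k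
  proof -
    have mem: "x j - x k \<in> M" "(1/2) *\<^sub>R (x j + x k) \<in> M"
      using x(1) M(1) by (auto intro!: subspace_diff subspace_scale subspace_add simp del: scaleR_add_right)
    have "\<alpha> * (dist (x j) (x k))\<^sup>2 \<le> b (x j - x k) (x j - x k)"
      unfolding dist_norm by (rule \<alpha>(2)[OF mem(1)])
    also have "\<dots> \<le> 2 / real (Suc j) + 2 / real (Suc k)"
      unfolding parallelogram using d_le[OF mem(2)] x(2)[of j] x(2)[of k] by linarith
    finally show ?thesis .
  qed
  have "Cauchy x"
  proof (rule metric_CauchyI)
    fix e :: real assume "0 < e"
    then have "0 < \<alpha> * e\<^sup>2 / 4" using \<alpha>(1) by simp
    then obtain N where N: "1 / real (Suc N) < \<alpha> * e\<^sup>2 / 4"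
      using reals_Archimedean unfolding inverse_eq_divide by blast
    show "\<exists>N. \<forall>j\<ge>N. \<forall>k\<ge>N. dist (x j) (x k) < e"
    proof (intro exI allI impI)
      fix j k assume "N \<le> j" "N \<le> k"
      then have "1 / real (Suc j) \<le> 1 / real (Suc N)" "1 / real (Suc k) \<le> 1 / real (Suc N)"
        by (simp_all add: frac_le)
      then have "\<alpha> * (dist (x j) (x k))\<^sup>2 < \<alpha> * e\<^sup>2" using close[of j k] N by linarith
      then have "(dist (x j) (x k))\<^sup>2 < e\<^sup>2" using \<alpha>(1) by simp
      then show "dist (x j) (x k) < e" using \<open>0 < e\<close> by (meson less_imp_le power2_less_imp_less)
    qed
  qed
  then obtain n where lim: "x \<longlonglongrightarrow> n" using Cauchy_convergent convergent_def by blast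
  have n: "n \<in> M" using M(2) lim x(1) closed_sequentially by blast
  have "(\<lambda>k. \<phi> (x k)) \<longlonglongrightarrow> \<phi> n"
    unfolding \<phi>_def by (intro tendsto_intros b.tendsto l.tendsto lim)
  moreover have "(\<lambda>k. d + 1 / real (Suc k)) \<longlonglongrightarrow> d + 0"
    by (intro tendsto_add tendsto_const LIMSEQ_Suc lim_const_over_n)
  ultimately have "\<phi> n \<le> d + 0"
    using x(2) by (intro LIMSEQ_le) (auto intro: less_imp_le)
  then have min: "\<phi> n \<le> \<phi> m" if "m \<in> M" for m using d_le[OF that] by simp
  have "b n m = l m" if m: "m \<in> M" for m
  proof -
    define c where "c = b n m - l m"
    \<comment> \<open>The added 1 keeps the divisor positive when \<open>b m m\<close> vanishes. The
      choice of \<open>t\<close> then turns the variation bound into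
      \<open>- (c\<^sup>2 / s)\<close>, which forces \<open>c = 0\<close>.\<close>
    define s where "s = b m m + 1"
    define t where "t = - c / s"
    have "0 \<le> b m m"
      using order_trans[OF _ \<alpha>(2)[OF m], of 0] \<alpha>(1) by simp
    then have s: "0 < s" by (simp add: s_def)
    have "n + t *\<^sub>R m \<in> M" using n m M(1) by (intro subspace_add subspace_scale)
    from min[OF this] have "0 \<le> 2 * t * c + t\<^sup>2 * b m m"
      unfolding \<phi>_def c_def
      by (simp add: b.add_left b.add_right b.scaleR_left b.scaleR_right
          l.add l.scaleR sym[of m n] algebra_simps power2_eq_square)
    also have "\<dots> \<le> 2 * t * c + t\<^sup>2 * s" by (simp add: s_def algebra_simps)
    also have "\<dots> = - (c\<^sup>2 / s)"
      unfolding t_def using s by (simp add: field_simps power2_eq_square)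
    finally have "c\<^sup>2 / s \<le> 0" by simp
    then have "c = 0" using s by (simp add: divide_le_0_iff)
    then show ?thesis by (simp add: c_def)
  qed
  with n show thesis by (rule that)
qed

text \<open>Baire category on the complete space \<open>M\<close>: the relatively closed sets
  \<open>A n\<close> cover \<open>M\<close>, so one of them contains a relative ball, and
  translating this ball to the origin gives the bound. The weights stand on the right-hand side so
  that they may vanish.\<close>

lemma banach_steinhaus_weighted:
  fixes L :: "'k \<Rightarrow> 'a::banach \<Rightarrow> 'b::real_normed_vector" and w :: "'k \<Rightarrow> real"
  assumes M: "subspace M" "closed M"
    and L: "\<And>k. bounded_linear (L k)"
    and pointwise: "\<And>y. y \<in> M \<Longrightarrow> \<exists>C. \<forall>k. norm (L k y) \<le> C * w k" and w: "\<And>k. 0 \<le> w k"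
  obtains K where "0 < K" "\<And>y k. y \<in> M \<Longrightarrow> norm (L k y) \<le> K * w k * norm y"
proof -
  define A where "A n = M \<inter> {y. \<forall>k. norm (L k y) \<le> real n * w k}" for n
  have "closed {y. \<forall>k. norm (L k y) \<le> real n * w k}" for n
    unfolding Collect_all_eq
    by (intro closed_INT ballI closed_Collect_le continuous_intros
        linear_continuous_on[OF L])
  then have closedin: "closedin (top_of_set M) (A n)" for n
    unfolding A_def by (auto simp: closedin_closed)
  have "\<exists>n. y \<in> A n" if y: "y \<in> M" for y
  proof -
    obtain C where C: "\<And>k. norm (L k y) \<le> C * w k" using pointwise[OF y] by blast
    obtain n where "C \<le> real n" using real_arch_simple by blast
    then have "norm (L k y) \<le> real n * w k" for k
      using C[of k] w[of k] by (meson mult_right_mono order_trans)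
    then show ?thesis using y by (auto simp: A_def)
  qed
  then have Un: "\<Union>(range A) = M" by (auto simp: A_def)
  have M0: "0 \<in> M" using M(1) by (rule subspace_0)
  have "\<exists>n. top_of_set M interior_of A n \<noteq> {}"
  proof (rule ccontr)
    assume "\<not> ?thesis"
    then have "top_of_set M interior_of \<Union>(range A) = {}"
      using closedin M(2)
      by (intro Baire_category_alt disjI1 completely_metrizable_space_closedin
          completely_metrizable_space_euclidean) auto
    then show False
      unfolding Un using M0 interior_of_topspace[of "top_of_set M"] by auto
  qed
  then obtain n y0 where "y0 \<in> top_of_set M interior_of A n" by blast
  then obtain U where U: "openin (top_of_set M) U" "y0 \<in> U" "U \<subseteq> A n"
    unfolding interior_of_def by blast
  then obtain e where e: "0 < e" "ball y0 e \<inter> M \<subseteq> U"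
    unfolding openin_contains_ball by blast
  have y0: "y0 \<in> M" "y0 \<in> A n" using U by (auto simp: A_def)
  \<comment> \<open>A step of length \<open>e / 2\<close> stays in the ball, and the bounds at its
    two ends add up to \<open>2 * real n * w k\<close>; dividing by \<open>s\<close> gives the
    factor 4. The added 1 makes \<open>K\<close> positive even for \<open>n = 0\<close>.\<close>
  define K where "K = 4 * (real n + 1) / e"
  have "norm (L k y) \<le> K * w k * norm y" if y: "y \<in> M" for y k
  proof (cases "y = 0")
    case True
    then show ?thesis using linear_0[OF bounded_linear.linear[OF L]] by simp
  next
    case False
    interpret bounded_linear "L k" by (rule L)
    define s where "s = e / (2 * norm y)"
    have s: "0 < s" using e False by (simp add: s_def)
    have "y0 + s *\<^sub>R y \<in> M" using y0 y M(1) by (intro subspace_add subspace_scale)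
    moreover have "y0 + s *\<^sub>R y \<in> ball y0 e"
      using e False by (simp add: dist_norm s_def)
    ultimately have "y0 + s *\<^sub>R y \<in> A n" using e(2) U(3) by blast
    then have "norm (L k (y0 + s *\<^sub>R y)) \<le> real n * w k" "norm (L k y0) \<le> real n * w k"
      using y0 by (auto simp: A_def)
    moreover have "s * norm (L k y) = norm (L k (y0 + s *\<^sub>R y) - L k y0)"
      using s by (simp add: add scaleR)
    ultimately have "s * norm (L k y) \<le> 2 * real n * w k"
      using norm_triangle_ineq4[of "L k (y0 + s *\<^sub>R y)" "L k y0"] by linarith
    also have "\<dots> \<le> 2 * (real n + 1) * w k" using w[of k] by (intro mult_right_mono) auto
    finally have "norm (L k y) \<le> 2 * (real n + 1) * w k / s"
      using s by (simp add: field_simps)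
    also have "\<dots> = K * w k * norm y"
      using e False by (simp add: K_def s_def field_simps)
    finally show ?thesis .
  qed
  moreover have "0 < K" using e by (simp add: K_def)
  ultimately show thesis using that by blast
qed

section \<open>Maximal uniformly definite subspaces\<close>

context krein_space
begin

section \<open>Real structure, Cauchy-Schwarz and continuity of the form\<close>

lemma scaleR_eq_scale: "r *\<^sub>R x = complex_of_real r *\<^sub>C x"
  by (simp add: scale_of_real)

lemma real_subspace: "cvs.subspace M \<Longrightarrow> subspace M"
  unfolding subspace_def cvs.subspace_def by (simp add: scaleR_eq_scale)

lemma form_zero_left [simp]: "form 0 x = 0" and form_zero_right [simp]: "form x 0 = 0"
  using form_add_left[of 0 0 x] form_add_right[of x 0 0] by simp_all

lemma zero_mem_Hp_Hm: "0 \<in> Hp" "0 \<in> Hm"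
  using Hp_Int_Hm by auto

lemma norm_Hp: "u \<in> Hp \<Longrightarrow> (norm u)\<^sup>2 = Re (form u u)"
  using norm_decomp[of u 0] zero_mem_Hp_Hm by simp

lemma norm_Hm: "v \<in> Hm \<Longrightarrow> (norm v)\<^sup>2 = - Re (form v v)"
  using norm_decomp[of 0 v] zero_mem_Hp_Hm by simp

lemma norm_eq_proj: "(norm x)\<^sup>2 = (norm (proj_plus x))\<^sup>2 + (norm (proj_minus x))\<^sup>2"
  using norm_decomp[OF proj_plus_in proj_minus_in, of x x]
  by (simp add: proj_sum norm_Hp[OF proj_plus_in] norm_Hm[OF proj_minus_in])

lemma form_proj: "form x y = form (proj_plus x) (proj_plus y) + form (proj_minus x) (proj_minus y)"
proof -
  have "form x y = form (proj_plus x + proj_minus x) (proj_plus y + proj_minus y)"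
    by (simp add: proj_sum)
  then show ?thesis
    unfolding form_add_left form_add_right
    by (simp add: Hp_orth_Hm[OF proj_plus_in proj_minus_in] Hm_orth_Hp[OF proj_minus_in proj_plus_in])
qed

lemma form_self_eq_proj: "Re (form x x) = (norm (proj_plus x))\<^sup>2 - (norm (proj_minus x))\<^sup>2"
  using form_proj[of x x] by (simp add: norm_Hp[OF proj_plus_in] norm_Hm[OF proj_minus_in])

lemma norm_proj_le: "norm (proj_plus x) \<le> norm x" "norm (proj_minus x) \<le> norm x"
  using norm_eq_proj[of x] by (auto intro: power2_le_imp_le)

lemma norm_J: "norm (J x) = norm x"
proof -
  have "complex_of_real ((norm (J x))\<^sup>2) = complex_of_real ((norm x)\<^sup>2)"
    by (metis ip_self J_selfadjoint J_J)
  then have "(norm (J x))\<^sup>2 = (norm x)\<^sup>2" by (simp only: of_real_eq_iff)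
  then show ?thesis by simp
qed

lemma ip_add_right: "ip x (y + z) = ip x y + ip x z"
  by (simp add: ip_def proj_add form_add_right)

lemma ip_scale_right: "ip x (c *\<^sub>C y) = cnj c * ip x y"
  by (simp add: ip_def proj_scale form_scale_right algebra_simps)

text \<open>The triangle inequality for \<open>norm\<close> gives the estimate for the real part.
  Multiplying \<open>y\<close> by the phase of \<open>ip x y\<close> makes the inner product real
  and nonnegative without changing the norm of \<open>y\<close>.\<close>

lemma cmod_ip_le: "cmod (ip x y) \<le> norm x * norm y"
proof -
  have Re_le: "Re (ip a b) \<le> norm a * norm b" for a b
  proof -
    have "complex_of_real ((norm (a + b))\<^sup>2)
        = complex_of_real ((norm a)\<^sup>2) + complex_of_real ((norm b)\<^sup>2) + (ip a b + cnj (ip a b))"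
      unfolding ip_self[symmetric] ip_add_left ip_add_right using ip_commute[of a b] by simp
    then have "Re (complex_of_real ((norm (a + b))\<^sup>2))
        = Re (complex_of_real ((norm a)\<^sup>2) + complex_of_real ((norm b)\<^sup>2) + (ip a b + cnj (ip a b)))"
      by (rule arg_cong)
    then have "(norm (a + b))\<^sup>2 = (norm a)\<^sup>2 + (norm b)\<^sup>2 + 2 * Re (ip a b)"
      by (simp del: of_real_power)
    moreover have "(norm (a + b))\<^sup>2 \<le> (norm a + norm b)\<^sup>2"
      by (intro power_mono norm_triangle_ineq norm_ge_zero)
    ultimately show ?thesis by (simp add: power2_sum)
  qed
  show ?thesis
  proof (cases "ip x y = 0")
    case False
    define c where "c = sgn (ip x y)"
    have "ip x (c *\<^sub>C y) = complex_of_real (cmod (ip x y))"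
      unfolding ip_scale_right c_def sgn_eq using False
      by (simp add: mult.commute[of "cnj _"] flip: complex_norm_square) (simp add: power2_eq_square)
    moreover have "norm (c *\<^sub>C y) = norm y"
      using False by (simp add: norm_scale c_def norm_sgn)
    ultimately show ?thesis using Re_le[of x "c *\<^sub>C y"] by simp
  qed simp
qed

lemma cmod_form_le: "cmod (form x y) \<le> norm x * norm y"
  using cmod_ip_le[of "J x" y] by (simp add: form_eq_ip_J norm_J)

lemma bounded_bilinear_form: "bounded_bilinear form"
proof (rule bounded_bilinear.intro)
  show "\<exists>K. \<forall>a b. cmod (form a b) \<le> norm a * norm b * K"
    using cmod_form_le by (intro exI[of _ 1]) simp
qed (simp_all add: form_add_left form_add_right scaleR_eq_scale form_scale_left form_scale_right
    scaleR_conv_of_real)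

lemma bounded_linear_form_left: "bounded_linear (\<lambda>x. form x y)"
  using bounded_bilinear_form by (rule bounded_bilinear.bounded_linear_left)

lemma bounded_linear_Re_form: "bounded_linear (\<lambda>y. Re (form x y))"
  by (intro bounded_linear_compose[OF bounded_linear_Re]
      bounded_bilinear.bounded_linear_right[OF bounded_bilinear_form])

text \<open>Replacing \<open>z\<close> by \<open>\<i> *\<^sub>C z\<close> turns the imaginary part
  into a real part. This upgrades conclusions of the real Riesz lemma to complex identities.\<close>

lemma form_eqI_Re:
  assumes N: "cvs.subspace N" and eq: "\<And>z. z \<in> N \<Longrightarrow> Re (form x z) = Re (form y z)" and z: "z \<in> N"
  shows "form x z = form y z"
proof (rule complex_eqI)
  show "Re (form x z) = Re (form y z)" by (rule eq[OF z])
  have "Re (form x (\<i> *\<^sub>C z)) = Re (form y (\<i> *\<^sub>C z))"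
    by (rule eq) (rule cvs.subspace_scale[OF N z])
  then show "Im (form x z) = Im (form y z)" by (simp add: form_scale_right)
qed

lemma bounded_linear_proj: "bounded_linear proj_plus" "bounded_linear proj_minus"
  by (rule bounded_linear_intro[where K = 1];
      simp add: proj_add proj_scale scaleR_eq_scale norm_proj_le)+

lemma subspace_closure:
  assumes "cvs.subspace M"
  shows "cvs.subspace (closure M)"
proof -
  have "x + y \<in> closure M" if xy: "x \<in> closure M" "y \<in> closure M" for x y
  proof -
    obtain f g where fg: "\<And>n. f n \<in> M" "f \<longlonglongrightarrow> x" "\<And>n. g n \<in> M" "g \<longlonglongrightarrow> y"
      using xy unfolding closure_sequential by blast
    then have "\<forall>n. f n + g n \<in> M" "(\<lambda>n. f n + g n) \<longlonglongrightarrow> x + y"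
      using assms by (auto intro: cvs.subspace_add tendsto_add)
    then show ?thesis unfolding closure_sequential by (intro exI[of _ "\<lambda>n. f n + g n"]) simp
  qed
  moreover have "c *\<^sub>C x \<in> closure M" if "x \<in> closure M" for c x
  proof -
    have "(\<lambda>x. c *\<^sub>C x) ` closure M \<subseteq> closure ((\<lambda>x. c *\<^sub>C x) ` M)"
      by (rule closure_bounded_linear_image_subset[OF bounded_linear_scale])
    also have "\<dots> \<subseteq> closure M"
      using assms by (intro closure_mono) (auto intro: cvs.subspace_scale)
    finally show ?thesis using that by blast
  qed
  moreover have "0 \<in> closure M" using cvs.subspace_0[OF assms] closure_subset by blast
  ultimately show ?thesis unfolding cvs.subspace_def by blast
qed

lemma continuous_form_self: "continuous_on A (\<lambda>x. Re (form x x))"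
  by (intro continuous_intros bounded_bilinear.continuous_on[OF bounded_bilinear_form])

section \<open>Closedness and the projection criterion for maximal positive subspaces\<close>

lemma uniformly_J_positive_closure:
  assumes "uniformly_J_positive M"
  shows "uniformly_J_positive (closure M)"
proof -
  obtain \<alpha> where \<alpha>: "0 < \<alpha>" "\<And>x. x \<in> M \<Longrightarrow> \<alpha> * (norm x)\<^sup>2 \<le> Re (form x x)"
    and M: "cvs.subspace M"
    using assms unfolding uniformly_J_positive_def by blast
  have "closed {x. \<alpha> * (norm x)\<^sup>2 \<le> Re (form x x)}"
    by (intro closed_Collect_le continuous_intros continuous_form_self)
  then have "closure M \<subseteq> {x. \<alpha> * (norm x)\<^sup>2 \<le> Re (form x x)}"
    using \<alpha>(2) by (intro closure_minimal) auto
  then show ?thesis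
    unfolding uniformly_J_positive_def using \<alpha>(1) subspace_closure[OF M] by blast
qed

text \<open>The closure is again uniformly positive with the same constant, so maximality leaves no
  room between \<open>M\<close> and its closure.\<close>

lemma maximal_uniformly_J_positive_closed:
  assumes "maximal_uniformly_J_positive M"
  shows "closed M"
proof -
  have "uniformly_J_positive (closure M)"
    using assms unfolding maximal_uniformly_J_positive_def
    by (intro uniformly_J_positive_closure) simp
  then have "closure M = M"
    using assms closure_subset unfolding maximal_uniformly_J_positive_def by blast
  then show ?thesis by (metis closed_closure)
qed

text \<open>The form is the difference, and the squared norm the sum, of the squared norms of the
  two components. Thus \<open>M\<close> is the graph of a strict contraction defined on its
  projection to \<open>Hp\<close>.\<close>

lemma uniformly_J_positive_proj:
  assumes "uniformly_J_positive M"
  obtains \<alpha> where "0 < \<alpha>" "\<alpha> \<le> 1"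
    "\<And>x. x \<in> M \<Longrightarrow> (norm (proj_minus x))\<^sup>2 \<le> (1 - \<alpha>) * (norm (proj_plus x))\<^sup>2"
    "\<And>x. x \<in> M \<Longrightarrow> \<alpha> * (norm x)\<^sup>2 \<le> Re (form x x)"
proof -
  obtain \<beta> where \<beta>: "0 < \<beta>" "\<And>x. x \<in> M \<Longrightarrow> \<beta> * (norm x)\<^sup>2 \<le> Re (form x x)"
    using assms unfolding uniformly_J_positive_def by blast
  \<comment> \<open>Shrinking the constant to at most 1 keeps the contraction factor
    \<open>1 - \<alpha>\<close> nonnegative.\<close>
  define \<alpha> where "\<alpha> = min \<beta> 1"
  have \<alpha>: "0 < \<alpha>" "\<alpha> \<le> 1" using \<beta>(1) by (auto simp: \<alpha>_def)
  have le: "\<alpha> * (norm x)\<^sup>2 \<le> Re (form x x)" if "x \<in> M" for x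
  proof -
    have "\<alpha> * (norm x)\<^sup>2 \<le> \<beta> * (norm x)\<^sup>2" by (intro mult_right_mono) (auto simp: \<alpha>_def)
    then show ?thesis using \<beta>(2)[OF that] by linarith
  qed
  have "(norm (proj_minus x))\<^sup>2 \<le> (1 - \<alpha>) * (norm (proj_plus x))\<^sup>2" if "x \<in> M" for x
  proof -
    have "\<alpha> * (norm (proj_plus x))\<^sup>2 \<le> \<alpha> * (norm x)\<^sup>2"
      using \<alpha>(1) norm_eq_proj[of x] by (intro mult_left_mono) auto
    then show ?thesis using le[OF that] form_self_eq_proj[of x] by (simp add: algebra_simps)
  qed
  with \<alpha> le show thesis using that by blast
qed

text \<open>A nonnegative vector has its \<open>Hm\<close> component dominated by its
  \<open>Hp\<close> component; 2 is a convenient bound for the square root of 2. In particular, such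
  a vector vanishes when its \<open>Hp\<close> component does.\<close>

lemma norm_le_proj_plus:
  assumes "0 \<le> Re (form x x)"
  shows "norm x \<le> 2 * norm (proj_plus x)"
proof -
  have "(norm x)\<^sup>2 \<le> (2 * norm (proj_plus x))\<^sup>2"
    unfolding norm_eq_proj[of x]
    using assms zero_le_power2[of "norm (proj_plus x)"]
    unfolding form_self_eq_proj power2_eq_square by linarith
  then show ?thesis by (rule power2_le_imp_le) simp
qed

text \<open>A vector of a larger positive subspace differs from the vector of \<open>M\<close> with
  the same \<open>Hp\<close> component by a nonnegative vector without \<open>Hp\<close> component,
  which must be zero.\<close>

lemma maximal_uniformly_J_positiveI:
  assumes M: "uniformly_J_positive M" and surj: "\<And>u. u \<in> Hp \<Longrightarrow> \<exists>m\<in>M. proj_plus m = u"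
  shows "maximal_uniformly_J_positive M"
  unfolding maximal_uniformly_J_positive_def
proof (intro conjI allI impI M)
  fix M' assume M': "uniformly_J_positive M' \<and> M \<subseteq> M'"
  then have sub: "cvs.subspace M'" by (simp add: uniformly_J_positive_def)
  have "x \<in> M" if x: "x \<in> M'" for x
  proof -
    obtain m where m: "m \<in> M" "proj_plus m = proj_plus x" using surj[OF proj_plus_in] by metis
    have mem: "x - m \<in> M'" using x m M' sub by (auto intro: cvs.subspace_diff)
    have "proj_plus (x - m) = 0"
      using m(2) by (simp add: linear_diff[OF bounded_linear.linear[OF bounded_linear_proj(1)]])
    moreover obtain \<alpha> where "0 < \<alpha>" "\<alpha> * (norm (x - m))\<^sup>2 \<le> Re (form (x - m) (x - m))"
      using M' mem unfolding uniformly_J_positive_def by blast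
    then have "0 \<le> Re (form (x - m) (x - m))"
      using order_trans[of 0 "\<alpha> * (norm (x - m))\<^sup>2"] by simp
    ultimately have "x = m" using norm_le_proj_plus[of "x - m"] by simp
    then show ?thesis using m(1) by simp
  qed
  then show "M' = M" using M' by blast
qed

lemma bounded_bilinear_Re:
  assumes "bounded_bilinear (h :: 'a \<Rightarrow> 'a \<Rightarrow> complex)"
  shows "bounded_bilinear (\<lambda>x y. Re (h x y))"
proof -
  interpret h: bounded_bilinear h by fact
  obtain K where K: "\<And>x y. norm (h x y) \<le> norm x * norm y * K" using h.bounded by blast
  have "norm (Re (h x y)) \<le> norm x * norm y * K" for x y
    using abs_Re_le_cmod[of "h x y"] K[of x y] by simp
  then show ?thesis
    by (intro bounded_bilinear.intro) (auto simp: h.add_left h.add_right h.scaleR_left h.scaleR_right)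
qed

lemma bounded_bilinear_proj_plus:
  "bounded_bilinear (\<lambda>x y. Re (form (proj_plus x) (proj_plus y)))"
  by (rule bounded_bilinear_Re
      bounded_bilinear.comp[OF bounded_bilinear_form bounded_linear_proj(1) bounded_linear_proj(1)])+

lemma Re_form_commute: "Re (form x y) = Re (form y x)"
  using form_hermitian[of x y] by simp

text \<open>The pairing of the \<open>Hp\<close> components dominates \<open>form x x\<close> and is
  therefore coercive on \<open>M\<close>. Applying the Riesz lemma on \<open>M\<close> itself avoids
  a separate closedness proof for its projection.\<close>

lemma proj_plus_riesz:
  assumes M: "uniformly_J_positive M" "closed M" and l: "bounded_linear l"
  obtains n where "n \<in> M" "\<And>m. m \<in> M \<Longrightarrow> Re (form (proj_plus n) (proj_plus m)) = l m"
proof -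
  have sub: "cvs.subspace M" using M(1) by (simp add: uniformly_J_positive_def)
  obtain \<alpha> where \<alpha>: "0 < \<alpha>" "\<And>x. x \<in> M \<Longrightarrow> \<alpha> * (norm x)\<^sup>2 \<le> Re (form x x)"
    by (rule uniformly_J_positive_proj[OF M(1)]) blast
  show thesis
  proof (rule riesz_symmetric_form[OF bounded_bilinear_proj_plus Re_form_commute
        real_subspace[OF sub] M(2) \<alpha>(1) _ l])
    fix x assume "x \<in> M"
    then have "\<alpha> * (norm x)\<^sup>2 \<le> Re (form x x)" by (rule \<alpha>(2))
    also have "\<dots> \<le> Re (form (proj_plus x) (proj_plus x))"
      using form_self_eq_proj[of x] norm_Hp[OF proj_plus_in, of x] by simp
    finally show "\<alpha> * (norm x)\<^sup>2 \<le> Re (form (proj_plus x) (proj_plus x))" .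
  qed (use that in blast)
qed

text \<open>Otherwise a vector of \<open>Hp\<close> orthogonal to the projection of \<open>M\<close> could be adjoined to \<open>M\<close>.\<close>

lemma maximal_uniformly_J_positive_proj:
  assumes max: "maximal_uniformly_J_positive M" and u: "u \<in> Hp"
  obtains m where "m \<in> M" "proj_plus m = u"
proof -
  have M: "uniformly_J_positive M" using max by (simp add: maximal_uniformly_J_positive_def)
  then have sub: "cvs.subspace M" by (simp add: uniformly_J_positive_def)
  obtain \<alpha> where \<alpha>: "0 < \<alpha>" "\<alpha> \<le> 1" "\<And>x. x \<in> M \<Longrightarrow> \<alpha> * (norm x)\<^sup>2 \<le> Re (form x x)"
    by (rule uniformly_J_positive_proj[OF M]) blast
  \<comment> \<open>\<open>proj_plus n\<close> is the orthogonal projection of \<open>u\<close> onto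
    the projection of \<open>M\<close>; the remainder \<open>w\<close> is shown to vanish.\<close>
  obtain n where n: "n \<in> M"
    "\<And>m. m \<in> M \<Longrightarrow> Re (form (proj_plus n) (proj_plus m)) = Re (form u (proj_plus m))"
    by (rule proj_plus_riesz[OF M maximal_uniformly_J_positive_closed[OF max]
          bounded_linear_compose[OF bounded_linear_Re_form bounded_linear_proj(1)], of u]) blast
  define w where "w = u - proj_plus n"
  have w: "w \<in> Hp" unfolding w_def by (intro cvs.subspace_diff subspace_Hp u proj_plus_in)
  have wproj: "proj_plus w = w" "proj_minus w = 0" using proj_eq[OF w zero_mem_Hp_Hm(2)] by simp_all
  have orth: "Re (form w m) = 0" if "m \<in> M" for m
  proof -
    have "form w m = form w (proj_plus m)" using form_proj[of w m] by (simp add: wproj)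
    also have "\<dots> = form u (proj_plus m) - form (proj_plus n) (proj_plus m)"
      by (simp add: w_def form_diff_left)
    finally show ?thesis using n(2)[OF that] by simp
  qed
  define M' where "M' = {m + c *\<^sub>C w |m c. m \<in> M}"
  have "cvs.subspace M'"
  proof (rule cvs.subspaceI)
    show "0 \<in> M'" unfolding M'_def using cvs.subspace_0[OF sub] by force
    fix x y assume "x \<in> M'" "y \<in> M'"
    then obtain m c m' c' where xy: "x = m + c *\<^sub>C w" "y = m' + c' *\<^sub>C w" "m \<in> M" "m' \<in> M"
      unfolding M'_def by blast
    then have "x + y = (m + m') + (c + c') *\<^sub>C w" by (simp add: cvs.scale_left_distrib)
    then show "x + y \<in> M'" unfolding M'_def using cvs.subspace_add[OF sub xy(3,4)] by blast
  next
    fix a x assume "x \<in> M'"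
    then obtain m c where x: "x = m + c *\<^sub>C w" "m \<in> M" unfolding M'_def by blast
    then have "a *\<^sub>C x = a *\<^sub>C m + (a * c) *\<^sub>C w" by (simp add: cvs.scale_right_distrib)
    then show "a *\<^sub>C x \<in> M'" unfolding M'_def using cvs.subspace_scale[OF sub x(2)] by blast
  qed
  \<comment> \<open>Since \<open>w\<close> is orthogonal to \<open>M\<close> for the form, the
    values on \<open>m\<close> and on the multiple of \<open>w\<close> add up. Bounding the square
    of a sum by twice the sum of squares costs the factor 1/2, and \<open>\<alpha> \<le> 1\<close>
    handles the \<open>Hp\<close> summand.\<close>
  moreover have "\<alpha> / 2 * (norm x)\<^sup>2 \<le> Re (form x x)" if xM': "x \<in> M'" for x
  proof -
    obtain m c where x: "x = m + c *\<^sub>C w" "m \<in> M" using xM' unfolding M'_def by blast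
    have cw: "c *\<^sub>C w \<in> Hp" using subspace_Hp w by (rule cvs.subspace_scale)
    have "form w m = form 0 m" by (rule form_eqI_Re[OF sub _ x(2)]) (simp add: orth)
    then have 0: "form (c *\<^sub>C w) m = 0" by (simp add: form_scale_left)
    then have "form m (c *\<^sub>C w) = 0" by (subst form_hermitian) simp
    with 0 have "Re (form x x) = Re (form m m) + Re (form (c *\<^sub>C w) (c *\<^sub>C w))"
      by (simp add: x form_add_left form_add_right)
    then have xx: "Re (form x x) = Re (form m m) + (norm (c *\<^sub>C w))\<^sup>2" by (simp add: norm_Hp[OF cw])
    have "(norm x)\<^sup>2 \<le> (norm m + norm (c *\<^sub>C w))\<^sup>2"
      unfolding x by (intro power_mono norm_triangle_ineq norm_ge_zero)
    also have "\<dots> \<le> 2 * ((norm m)\<^sup>2 + (norm (c *\<^sub>C w))\<^sup>2)"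
      using zero_le_power2[of "norm m - norm (c *\<^sub>C w)"] by (simp add: power2_sum power2_diff)
    finally have "\<alpha> / 2 * (norm x)\<^sup>2 \<le> \<alpha> / 2 * (2 * ((norm m)\<^sup>2 + (norm (c *\<^sub>C w))\<^sup>2))"
      using \<alpha>(1) by (intro mult_left_mono) auto
    also have "\<dots> = \<alpha> * (norm m)\<^sup>2 + \<alpha> * (norm (c *\<^sub>C w))\<^sup>2" by (simp add: algebra_simps)
    also have "\<dots> \<le> Re (form m m) + 1 * (norm (c *\<^sub>C w))\<^sup>2"
      using \<alpha>(2) by (intro add_mono \<alpha>(3) x(2) mult_right_mono) auto
    finally show ?thesis by (simp add: xx)
  qed
  ultimately have "uniformly_J_positive M'"
    unfolding uniformly_J_positive_def using \<alpha>(1) by (meson half_gt_zero)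
  moreover have "M \<subseteq> M'" unfolding M'_def by (force intro: exI[of _ 0])
  ultimately have "M' = M" using max by (simp add: maximal_uniformly_J_positive_def)
  moreover have "0 + 1 *\<^sub>C w \<in> M'" unfolding M'_def using cvs.subspace_0[OF sub] by blast
  ultimately have "w \<in> M" by simp
  \<comment> \<open>Being in \<open>M\<close> and orthogonal to \<open>M\<close>, \<open>w\<close>
    is isotropic, and the form is definite on \<open>Hp\<close>.\<close>
  then have "Re (form w w) = 0" by (rule orth)
  then have "w = 0" using form_pos[OF w] by fastforce
  then show thesis using n(1) by (intro that[of n]) (simp_all add: w_def)
qed

section \<open>Exchange of signs and orthogonal companions\<close>

text \<open>Negating the form and exchanging the summands keeps the norm, so results for positive
  subspaces can be interpreted as results for negative ones.\<close>

lemma krein_space_dual: "krein_space scale (\<lambda>x y. - form x y) Hm Hp"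
proof (unfold_locales, goal_cases)
  case (4 y x)
  show ?case by (subst form_hermitian) simp
next
  case (8 x)
  then show ?case using Hp_plus_Hm[of x] by (metis add.commute)
next
  case (12 u v)
  then show ?case using norm_decomp[of v u] by (simp add: add.commute)
qed (use subspace_Hm subspace_Hp Hp_Int_Hm Hm_orth_Hp form_pos form_neg complete_Hp complete_Hm separable
  in \<open>auto simp: scale_of_real form_add_left form_scale_left\<close>)

definition J_orth :: "'a set \<Rightarrow> 'a set"
  where "J_orth M = {x. \<forall>y\<in>M. form x y = 0}"

lemma subspace_J_orth: "cvs.subspace (J_orth M)"
  by (rule cvs.subspaceI) (auto simp: J_orth_def form_add_left form_scale_left)

text \<open>The exchange of the projections compensates the change of sign, so both structures have
  the same Bessel families.\<close>

lemma dual_ip: "krein_space.ip (\<lambda>x y. - form x y) Hm Hp = ip"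
proof -
  interpret dual: krein_space scale "\<lambda>x y. - form x y" Hm Hp by (rule krein_space_dual)
  have "dual.proj_plus = proj_minus" "dual.proj_minus = proj_plus"
    by (simp_all add: fun_eq_iff dual.proj_plus_def proj_plus_def dual.proj_minus_def proj_minus_def)
  then show ?thesis by (simp add: fun_eq_iff ip_def dual.ip_def)
qed

lemma dual_maximal_uniformly_J_positive:
  "krein_space.maximal_uniformly_J_positive scale (\<lambda>x y. - form x y) M
    \<longleftrightarrow> maximal_uniformly_J_negative M"
proof -
  interpret dual: krein_space scale "\<lambda>x y. - form x y" Hm Hp by (rule krein_space_dual)
  have "a \<le> - b \<longleftrightarrow> b \<le> - a" for a b :: real by linarith
  then have "dual.uniformly_J_positive M \<longleftrightarrow> uniformly_J_negative M" for M
    by (simp add: dual.uniformly_J_positive_def uniformly_J_negative_def)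
  then show ?thesis
    by (simp add: dual.maximal_uniformly_J_positive_def maximal_uniformly_J_negative_def)
qed

lemma dual_J_orth: "krein_space.J_orth (\<lambda>x y. - form x y) M = J_orth M"
proof -
  interpret dual: krein_space scale "\<lambda>x y. - form x y" Hm Hp by (rule krein_space_dual)
  show ?thesis by (simp add: dual.J_orth_def J_orth_def)
qed

text \<open>Collects the dual forms of closedness, contraction, projection and Riesz representation
  in terms of the original form, ready for the study of \<open>J_orth M\<close>.\<close>

lemma maximal_uniformly_J_negativeD:
  assumes "maximal_uniformly_J_negative M"
  obtains \<alpha> where "cvs.subspace M" "closed M" "0 < \<alpha>" "\<alpha> \<le> 1"
    "\<forall>x\<in>M. (norm (proj_plus x))\<^sup>2 \<le> (1 - \<alpha>) * (norm (proj_minus x))\<^sup>2"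
    "\<forall>v\<in>Hm. \<exists>m\<in>M. proj_minus m = v"
    "\<forall>l. bounded_linear l \<longrightarrow>
      (\<exists>n\<in>M. \<forall>m\<in>M. - Re (form (proj_minus n) (proj_minus m)) = l m)"
proof -
  interpret dual: krein_space scale "\<lambda>x y. - form x y" Hm Hp by (rule krein_space_dual)
  have proj: "dual.proj_plus = proj_minus" "dual.proj_minus = proj_plus"
    by (simp_all add: fun_eq_iff dual.proj_plus_def proj_plus_def dual.proj_minus_def proj_minus_def)
  have max: "dual.maximal_uniformly_J_positive M"
    using assms by (simp only: dual_maximal_uniformly_J_positive)
  then have M: "dual.uniformly_J_positive M" by (simp add: dual.maximal_uniformly_J_positive_def)
  then have sub: "cvs.subspace M" by (simp add: dual.uniformly_J_positive_def)
  have cl: "closed M" by (rule dual.maximal_uniformly_J_positive_closed[OF max])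
  obtain \<alpha> where \<alpha>: "0 < \<alpha>" "\<alpha> \<le> 1"
    "\<forall>x\<in>M. (norm (proj_plus x))\<^sup>2 \<le> (1 - \<alpha>) * (norm (proj_minus x))\<^sup>2"
    by (rule dual.uniformly_J_positive_proj[OF M]) (rule that, auto simp: proj)
  have surj: "\<exists>m\<in>M. proj_minus m = v" if "v \<in> Hm" for v
    by (rule dual.maximal_uniformly_J_positive_proj[OF max that]) (auto simp: proj)
  have "\<exists>n\<in>M. \<forall>m\<in>M. - Re (form (proj_minus n) (proj_minus m)) = l m" if l: "bounded_linear l" for l
    by (rule dual.proj_plus_riesz[OF M cl l]) (auto simp: proj)
  then show thesis using sub cl \<alpha> surj by (intro that[of \<alpha>]) auto
qed

text \<open>\<open>M\<close> is the graph of a strict contraction from \<open>Hm\<close> to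
  \<open>Hp\<close>, and its companion is the graph of the adjoint contraction from
  \<open>Hp\<close> to \<open>Hm\<close>. The contraction bound gives uniform positivity, and the
  full domain \<open>Hp\<close> gives maximality.\<close>

lemma maximal_uniformly_J_positive_J_orth:
  assumes "maximal_uniformly_J_negative M"
  shows "maximal_uniformly_J_positive (J_orth M)"
proof -
  obtain \<alpha> where M: "cvs.subspace M" "closed M" and \<alpha>: "0 < \<alpha>" "\<alpha> \<le> 1"
    and contr: "\<forall>x\<in>M. (norm (proj_plus x))\<^sup>2 \<le> (1 - \<alpha>) * (norm (proj_minus x))\<^sup>2"
    and surj: "\<forall>v\<in>Hm. \<exists>m\<in>M. proj_minus m = v"
    and riesz: "\<forall>l. bounded_linear l \<longrightarrow>
      (\<exists>n\<in>M. \<forall>m\<in>M. - Re (form (proj_minus n) (proj_minus m)) = l m)"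
    by (rule maximal_uniformly_J_negativeD[OF assms])
  have bound: "\<alpha> / 2 * (norm x)\<^sup>2 \<le> Re (form x x)" if x: "x \<in> J_orth M" for x
  proof -
    define a b where "a = norm (proj_plus x)" and "b = norm (proj_minus x)"
    \<comment> \<open>Orthogonality to the vector of \<open>M\<close> above
      \<open>proj_minus x\<close> expresses \<open>b\<^sup>2\<close> through the \<open>Hp\<close>
      components, where the contraction bound applies.\<close>
    obtain m where m: "m \<in> M" "proj_minus m = proj_minus x" using bspec[OF surj proj_minus_in] by metis
    have "form x m = 0" using x m(1) by (simp add: J_orth_def)
    then have "form (proj_plus x) (proj_plus m) = - form (proj_minus x) (proj_minus x)"
      using form_proj[of x m] m(2) by (simp add: add_eq_0_iff)
    then have "b\<^sup>2 = Re (form (proj_plus x) (proj_plus m))"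
      using norm_Hm[OF proj_minus_in, of x] by (simp add: b_def)
    also have "\<dots> \<le> a * norm (proj_plus m)"
      using complex_Re_le_cmod cmod_form_le unfolding a_def by (rule order_trans)
    finally have "(b\<^sup>2)\<^sup>2 \<le> (a * norm (proj_plus m))\<^sup>2" by (intro power_mono) auto
    also have "\<dots> = a\<^sup>2 * (norm (proj_plus m))\<^sup>2" by (simp add: power_mult_distrib)
    also have "\<dots> \<le> a\<^sup>2 * ((1 - \<alpha>) * b\<^sup>2)"
      using bspec[OF contr m(1)] unfolding m(2) b_def by (intro mult_left_mono) auto
    finally have "b\<^sup>2 * b\<^sup>2 \<le> ((1 - \<alpha>) * a\<^sup>2) * b\<^sup>2" by (simp add: power2_eq_square ac_simps)
    then have le: "b\<^sup>2 \<le> (1 - \<alpha>) * a\<^sup>2"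
    proof (cases "b = 0")
      case False
      then have "0 < b\<^sup>2" by simp
      with \<open>b\<^sup>2 * b\<^sup>2 \<le> _\<close> show ?thesis by (rule mult_right_le_imp_le)
    qed (use \<alpha> in simp)
    have "0 \<le> \<alpha> * a\<^sup>2" using \<alpha> by simp
    then have "b\<^sup>2 \<le> a\<^sup>2" using le by (simp add: left_diff_distrib)
    \<comment> \<open>The bound on \<open>b\<close> leaves \<open>\<alpha> * a\<^sup>2\<close> for
      the value of the form, and \<open>a\<^sup>2\<close> is at least half of the squared
      norm.\<close>
    then have "\<alpha> / 2 * (a\<^sup>2 + b\<^sup>2) \<le> \<alpha> / 2 * (2 * a\<^sup>2)" using \<alpha> by (intro mult_left_mono) auto
    then show ?thesis
      using le unfolding norm_eq_proj[of x] form_self_eq_proj a_def b_def by (simp add: left_diff_distrib)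
  qed
  show ?thesis
  proof (rule maximal_uniformly_J_positiveI)
    show "uniformly_J_positive (J_orth M)"
      unfolding uniformly_J_positive_def using subspace_J_orth bound \<alpha>(1) by (meson half_gt_zero)
    fix u assume u: "u \<in> Hp"
    \<comment> \<open>\<open>proj_minus n\<close> is the value at \<open>u\<close> of the adjoint
      contraction, so adding it to \<open>u\<close> gives a vector of the companion above
      \<open>u\<close>.\<close>
    obtain n where n: "n \<in> M" "\<And>m. m \<in> M \<Longrightarrow> - Re (form (proj_minus n) (proj_minus m)) = Re (form u m)"
      using riesz bounded_linear_Re_form by blast
    define x where "x = u + proj_minus n"
    have "form x m = 0" if m: "m \<in> M" for m
    proof -
      have "form x m = form 0 m"
      proof (rule form_eqI_Re[OF M(1) _ m])
        fix z assume z: "z \<in> M"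
        have "form (proj_minus n) z = form (proj_minus n) (proj_minus z)"
          using form_proj[of "proj_minus n" z] proj_eq[OF zero_mem_Hp_Hm(1) proj_minus_in, of n] by simp
        then show "Re (form x z) = Re (form 0 z)" using n(2)[OF z] by (simp add: x_def form_add_left)
      qed
      then show ?thesis by simp
    qed
    then have "x \<in> J_orth M" by (simp add: J_orth_def)
    moreover have "proj_plus x = u" unfolding x_def by (rule proj_eq[OF u proj_minus_in])
    ultimately show "\<exists>m\<in>J_orth M. proj_plus m = u" by blast
  qed
qed

text \<open>If \<open>y\<close> and \<open>x\<close> have the same component in \<open>Hp\<close>, then \<open>y - x\<close> is negative, so expanding
  \<open>form (y - x) (y - x)\<close> bounds the real part of \<open>form y x\<close> from below.\<close>

lemma maximal_uniformly_J_positive_pairing: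
  assumes M: "maximal_uniformly_J_positive M" and N: "maximal_uniformly_J_positive N"
  obtains \<beta> where "0 < \<beta>"
    "\<And>x. x \<in> N \<Longrightarrow> \<exists>y\<in>M. norm y \<le> 2 * norm x \<and> \<beta> * (norm x)\<^sup>2 \<le> Re (form y x)"
proof -
  have "uniformly_J_positive M" "uniformly_J_positive N"
    using M N by (simp_all add: maximal_uniformly_J_positive_def)
  then obtain \<alpha> \<alpha>' where \<alpha>: "0 < \<alpha>" "\<And>x. x \<in> N \<Longrightarrow> \<alpha> * (norm x)\<^sup>2 \<le> Re (form x x)"
    and \<alpha>': "0 < \<alpha>'" "\<And>x. x \<in> M \<Longrightarrow> \<alpha>' * (norm x)\<^sup>2 \<le> Re (form x x)"
    unfolding uniformly_J_positive_def by blast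
  have "\<exists>y\<in>M. norm y \<le> 2 * norm x \<and> \<alpha> / 2 * (norm x)\<^sup>2 \<le> Re (form y x)" if x: "x \<in> N" for x
  proof -
    obtain y where y: "y \<in> M" "proj_plus y = proj_plus x"
      by (rule maximal_uniformly_J_positive_proj[OF M proj_plus_in[of x]])
    have pos: "0 \<le> Re (form y y)" using order_trans[OF _ \<alpha>'(2)[OF y(1)], of 0] \<alpha>'(1) by simp
    have "proj_plus (y - x) = 0"
      using y(2) by (simp add: linear_diff[OF bounded_linear.linear[OF bounded_linear_proj(1)]])
    then have "Re (form (y - x) (y - x)) \<le> 0" using form_self_eq_proj[of "y - x"] by simp
    moreover have "Re (form (y - x) (y - x)) = Re (form y y) + Re (form x x) - 2 * Re (form y x)"
      using Re_form_commute[of x y] by (simp add: form_diff_left form_diff_right)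
    ultimately have "\<alpha> / 2 * (norm x)\<^sup>2 \<le> Re (form y x)" using \<alpha>(2)[OF x] pos by simp
    moreover have "norm y \<le> 2 * norm x"
      using norm_le_proj_plus[OF pos] norm_proj_le(1)[of x] unfolding y(2) by linarith
    ultimately show ?thesis using y(1) by blast
  qed
  with \<alpha>(1) show thesis using that[of "\<alpha> / 2"] by simp
qed

section \<open>Bessel families\<close>

text \<open>\<open>J\<close> is an isometric involution, so the substitution of \<open>J x\<close>
  for \<open>x\<close> trades the inner product for the form with the same bound.\<close>

lemma bessel_family_form_iff:
  "bessel_family I f \<longleftrightarrow> (\<exists>B. \<forall>x. (\<lambda>i. (cmod (form x (f i)))\<^sup>2) summable_on I \<and>
             (\<Sum>\<^sub>\<infinity>i\<in>I. (cmod (form x (f i)))\<^sup>2) \<le> B * (norm x)\<^sup>2)"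
  (is "_ \<longleftrightarrow> (\<exists>B. \<forall>x. ?P B x)")
proof -
  have "ip x y = form (J x) y" for x y by (simp add: form_eq_ip_J J_J)
  then have "bessel_family I f \<longleftrightarrow> (\<exists>B. \<forall>x. ?P B (J x))"
    by (simp add: bessel_family_def norm_J)
  also have "\<dots> \<longleftrightarrow> (\<exists>B. \<forall>x. ?P B x)" by (metis J_J)
  finally show ?thesis .
qed

lemma bessel_family_subset:
  assumes "bessel_family I f" "A \<subseteq> I"
  shows "bessel_family A f"
proof -
  obtain B where B: "\<And>x. (\<lambda>i. (cmod (ip x (f i)))\<^sup>2) summable_on I"
    "\<And>x. (\<Sum>\<^sub>\<infinity>i\<in>I. (cmod (ip x (f i)))\<^sup>2) \<le> B * (norm x)\<^sup>2"
    using assms(1) unfolding bessel_family_def by blast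
  have sum: "(\<lambda>i. (cmod (ip x (f i)))\<^sup>2) summable_on A" for x
    by (rule summable_on_subset_banach[OF B(1) assms(2)])
  have "(\<Sum>\<^sub>\<infinity>i\<in>A. (cmod (ip x (f i)))\<^sup>2) \<le> (\<Sum>\<^sub>\<infinity>i\<in>I. (cmod (ip x (f i)))\<^sup>2)" for x
    by (rule infsum_mono_neutral) (use sum B(1) assms(2) in auto)
  with sum B(2) show ?thesis unfolding bessel_family_def by (meson order_trans)
qed

lemma bessel_family_Un:
  assumes "bessel_family A f" "bessel_family B f" "A \<inter> B = {}"
  shows "bessel_family (A \<union> B) f"
proof -
  obtain K L where K: "\<And>x. (\<lambda>i. (cmod (ip x (f i)))\<^sup>2) summable_on A"
    "\<And>x. (\<Sum>\<^sub>\<infinity>i\<in>A. (cmod (ip x (f i)))\<^sup>2) \<le> K * (norm x)\<^sup>2"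
    and L: "\<And>x. (\<lambda>i. (cmod (ip x (f i)))\<^sup>2) summable_on B"
    "\<And>x. (\<Sum>\<^sub>\<infinity>i\<in>B. (cmod (ip x (f i)))\<^sup>2) \<le> L * (norm x)\<^sup>2"
    using assms(1,2) unfolding bessel_family_def by blast
  have "(\<lambda>i. (cmod (ip x (f i)))\<^sup>2) summable_on (A \<union> B)" for x
    by (rule summable_on_Un_disjoint[OF K(1) L(1) assms(3)])
  moreover have "(\<Sum>\<^sub>\<infinity>i\<in>A \<union> B. (cmod (ip x (f i)))\<^sup>2) \<le> (K + L) * (norm x)\<^sup>2" for x
    using infsum_Un_disjoint[OF K(1) L(1) assms(3), of x] K(2)[of x] L(2)[of x]
    by (simp add: distrib_right)
  ultimately show ?thesis unfolding bessel_family_def by blast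
qed

end

section \<open>The two halves of the frame operator\<close>

context krein_space
begin

text \<open>The product of the synthesis operator of the subfamily with its adjoint taken with
  respect to the form. It carries no signs; the J-frame operator becomes a difference of two such
  operators.\<close>

definition frame_part :: "'i set \<Rightarrow> ('i \<Rightarrow> 'a) \<Rightarrow> 'a \<Rightarrow> 'a"
  where "frame_part A f x = (\<Sum>\<^sub>\<infinity>i\<in>A. form x (f i) *\<^sub>C f i)"

lemma bessel_coefficients_ell2:
  assumes "bessel_family A f"
  shows "(\<lambda>i. if i \<in> A then form x (f i) else 0) \<in> ell2 A"
proof -
  have "(\<lambda>i. (cmod (form x (f i)))\<^sup>2) summable_on A"
    using assms unfolding bessel_family_form_iff by blast
  then have "(\<lambda>i. (cmod (if i \<in> A then form x (f i) else 0))\<^sup>2) summable_on A"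
    by (rule summable_on_cong[THEN iffD1, rotated]) simp
  then show ?thesis by (simp add: ell2_def)
qed

lemma frame_part_eq_synthesis:
  "frame_part A f x = synthesis A f (\<lambda>i. if i \<in> A then form x (f i) else 0)"
  unfolding frame_part_def synthesis_def by (rule infsum_cong) simp

lemma frame_part_has_sum:
  assumes "bessel_family A f"
  shows "((\<lambda>i. form x (f i) *\<^sub>C f i) has_sum frame_part A f x) A"
proof -
  have "(\<lambda>i. form x (f i) *\<^sub>C f i) summable_on A"
    using synthesis_summable[OF assms bessel_coefficients_ell2[OF assms, of x]]
    by (rule summable_on_cong[THEN iffD1, rotated]) simp
  then show ?thesis unfolding frame_part_def by (rule has_sum_infsum)
qed

lemma frame_part_scale:
  assumes "bessel_family A f"
  shows "frame_part A f (c *\<^sub>C x) = c *\<^sub>C frame_part A f x"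
  using has_sum_bounded_linear[OF bounded_linear_scale[of c] frame_part_has_sum[OF assms, of x]]
  unfolding frame_part_def[of A f "c *\<^sub>C x"] form_scale_left cvs.scale_scale
  by (rule infsumI)

lemma bounded_linear_frame_part:
  assumes "bessel_family A f"
  shows "bounded_linear (frame_part A f)"
proof -
  obtain K where K: "\<And>c. c \<in> ell2 A \<Longrightarrow>
      norm (synthesis A f c) \<le> K * sqrt (\<Sum>\<^sub>\<infinity>i\<in>A. (cmod (c i))\<^sup>2)"
    using synthesis_bounded[OF assms] by blast
  obtain B where B: "\<And>x. (\<Sum>\<^sub>\<infinity>i\<in>A. (cmod (form x (f i)))\<^sup>2) \<le> B * (norm x)\<^sup>2"
    using assms unfolding bessel_family_form_iff by blast
  \<comment> \<open>The product of the bounds for analysis and synthesis. The absolute values are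
    there because neither constant is known to be nonnegative.\<close>
  have bound: "norm (frame_part A f x) \<le> norm x * (\<bar>K\<bar> * sqrt \<bar>B\<bar>)" for x
  proof -
    define c where "c i = (if i \<in> A then form x (f i) else 0)" for i
    have "(\<Sum>\<^sub>\<infinity>i\<in>A. (cmod (c i))\<^sup>2) = (\<Sum>\<^sub>\<infinity>i\<in>A. (cmod (form x (f i)))\<^sup>2)"
      by (rule infsum_cong) (simp add: c_def)
    also have "\<dots> \<le> B * (norm x)\<^sup>2" by (rule B)
    also have "\<dots> \<le> \<bar>B\<bar> * (norm x)\<^sup>2" by (intro mult_right_mono) auto
    finally have "sqrt (\<Sum>\<^sub>\<infinity>i\<in>A. (cmod (c i))\<^sup>2) \<le> sqrt \<bar>B\<bar> * norm x"
      by (metis abs_norm_cancel real_sqrt_abs real_sqrt_le_mono real_sqrt_mult)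
    moreover have "0 \<le> (\<Sum>\<^sub>\<infinity>i\<in>A. (cmod (c i))\<^sup>2)" by (rule infsum_nonneg) simp
    ultimately have "K * sqrt (\<Sum>\<^sub>\<infinity>i\<in>A. (cmod (c i))\<^sup>2) \<le> \<bar>K\<bar> * (sqrt \<bar>B\<bar> * norm x)"
      by (intro mult_mono) auto
    moreover have "norm (frame_part A f x) \<le> K * sqrt (\<Sum>\<^sub>\<infinity>i\<in>A. (cmod (c i))\<^sup>2)"
      unfolding frame_part_eq_synthesis c_def by (rule K[OF bessel_coefficients_ell2[OF assms]])
    ultimately show ?thesis by (simp add: mult_ac)
  qed
  have add: "frame_part A f (x + y) = frame_part A f x + frame_part A f y" for x y
    using has_sum_add[OF frame_part_has_sum[OF assms, of x] frame_part_has_sum[OF assms, of y]]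
    unfolding cvs.scale_left_distrib[symmetric] form_add_left[symmetric] frame_part_def[of A f "x + y"]
    by (rule infsumI)
  have scale: "frame_part A f (r *\<^sub>R x) = r *\<^sub>R frame_part A f x" for r x
    unfolding scaleR_eq_scale by (rule frame_part_scale[OF assms])
  show ?thesis by (rule bounded_linear_intro[OF add scale bound])
qed

lemma form_frame_part_has_sum:
  assumes "bessel_family A f"
  shows "((\<lambda>i. form x (f i) * form (f i) y) has_sum form (frame_part A f x) y) A"
  using has_sum_bounded_linear[OF bounded_linear_form_left frame_part_has_sum[OF assms, of x], of y]
  by (simp add: form_scale_left)

text \<open>Each summand is a number times its conjugate. Hence
  \<open>form (frame_part A f x) y\<close> is a positive semidefinite hermitian form on the whole
  space, although \<open>form\<close> is indefinite.\<close>

lemma form_frame_part_self: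
  assumes "bessel_family A f"
  shows "Re (form (frame_part A f x) x) = (\<Sum>\<^sub>\<infinity>i\<in>A. (cmod (form x (f i)))\<^sup>2)"
proof -
  have "((\<lambda>i. Re (form x (f i) * form (f i) x)) has_sum Re (form (frame_part A f x) x)) A"
    by (rule has_sum_Re[OF form_frame_part_has_sum[OF assms]])
  moreover have "Re (form x (f i) * form (f i) x) = (cmod (form x (f i)))\<^sup>2" for i
    by (subst (2) form_hermitian) (simp add: cmod_power2 flip: power2_eq_square)
  ultimately show ?thesis by (simp add: infsumI)
qed

lemma frame_part_selfadjoint:
  assumes "bessel_family A f"
  shows "form (frame_part A f x) y = form x (frame_part A f y)"
proof -
  have "((\<lambda>i. cnj (form y (f i) * form (f i) x)) has_sum cnj (form (frame_part A f y) x)) A"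
    by (rule has_sum_bounded_linear[OF bounded_linear_cnj form_frame_part_has_sum[OF assms]])
  moreover have "cnj (form y (f i) * form (f i) x) = form x (f i) * form (f i) y" for i
    by (simp flip: form_hermitian)
  ultimately have "form (frame_part A f x) y = cnj (form (frame_part A f y) x)"
    using has_sum_unique[OF form_frame_part_has_sum[OF assms, of x y]] by simp
  then show ?thesis by (simp flip: form_hermitian)
qed

lemma bounded_bilinear_frame_part:
  assumes "bessel_family A f"
  shows "bounded_bilinear (\<lambda>x y. Re (form (frame_part A f x) y))"
  by (intro bounded_bilinear_Re bounded_bilinear.comp[OF bounded_bilinear_form]
      bounded_linear_frame_part assms bounded_linear_ident)

text \<open>Cauchy-Schwarz for finite partial sums, passed to the limit. It supplies the pointwise
  bound for the uniform boundedness argument.\<close>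

lemma cmod_form_synthesis_le:
  assumes f: "bessel_family A f" and c: "c \<in> ell2 A"
  shows "cmod (form (synthesis A f c) x)
    \<le> sqrt (\<Sum>\<^sub>\<infinity>i\<in>A. (cmod (c i))\<^sup>2) * sqrt (\<Sum>\<^sub>\<infinity>i\<in>A. (cmod (form x (f i)))\<^sup>2)" (is "_ \<le> ?R")
proof (rule tendsto_upperbound)
  have "((\<lambda>i. c i *\<^sub>C f i) has_sum synthesis A f c) A"
    unfolding synthesis_def by (rule has_sum_infsum[OF synthesis_summable[OF f c]])
  then have "((\<lambda>i. form (c i *\<^sub>C f i) x) has_sum form (synthesis A f c) x) A"
    by (rule has_sum_bounded_linear[OF bounded_linear_form_left])
  then show "((\<lambda>F. cmod (\<Sum>i\<in>F. c i * form (f i) x)) \<longlongrightarrow> cmod (form (synthesis A f c) x))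
      (finite_subsets_at_top A)"
    unfolding has_sum_def form_scale_left by (rule tendsto_norm)
  have c2: "(\<lambda>i. (cmod (c i))\<^sup>2) summable_on A" using c by (simp add: ell2_def)
  have f2: "(\<lambda>i. (cmod (form x (f i)))\<^sup>2) summable_on A"
    using f unfolding bessel_family_form_iff by blast
  show "\<forall>\<^sub>F F in finite_subsets_at_top A. cmod (\<Sum>i\<in>F. c i * form (f i) x) \<le> ?R"
  proof (rule eventually_finite_subsets_at_top_weakI)
    fix F assume F: "finite F" "F \<subseteq> A"
    have "cmod (form (f i) x) = cmod (form x (f i))" for i by (subst form_hermitian) simp
    then have "cmod (\<Sum>i\<in>F. c i * form (f i) x) \<le> (\<Sum>i\<in>F. \<bar>cmod (c i)\<bar> * \<bar>cmod (form x (f i))\<bar>)"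
      by (intro order_trans[OF norm_sum]) (simp add: norm_mult)
    also have "\<dots> \<le> L2_set (\<lambda>i. cmod (c i)) F * L2_set (\<lambda>i. cmod (form x (f i))) F"
      by (rule L2_set_mult_ineq)
    also have "\<dots> \<le> ?R"
      unfolding L2_set_def using F c2 f2
      by (intro mult_mono real_sqrt_le_mono finite_sum_le_infsum) (auto intro: sum_nonneg infsum_nonneg)
    finally show "cmod (\<Sum>i\<in>F. c i * form (f i) x) \<le> ?R" .
  qed
qed simp

text \<open>The synthesis operator maps onto the complete space \<open>M\<close>, so by uniform boundedness the
  analysis operator is bounded below on \<open>N\<close>.\<close>

lemma frame_part_coercive:
  assumes f: "bessel_family A f"
    and M: "maximal_uniformly_J_positive (synthesis A f ` ell2 A)"
    and N: "maximal_uniformly_J_positive N"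
  obtains \<gamma> where "0 < \<gamma>" "\<And>x. x \<in> N \<Longrightarrow> \<gamma> * (norm x)\<^sup>2 \<le> Re (form (frame_part A f x) x)"
proof -
  let ?M = "synthesis A f ` ell2 A"
  \<comment> \<open>The norm of the analysis coefficients of \<open>x\<close> serves as weight, with
    the vectors \<open>x\<close> themselves as indices of the family of functionals.\<close>
  define w where "w x = sqrt (\<Sum>\<^sub>\<infinity>i\<in>A. (cmod (form x (f i)))\<^sup>2)" for x
  have w0: "0 \<le> w x" for x by (simp add: w_def infsum_nonneg)
  have sub: "cvs.subspace ?M"
    using M by (simp add: maximal_uniformly_J_positive_def uniformly_J_positive_def)
  obtain \<beta> where \<beta>: "0 < \<beta>"
    "\<And>x. x \<in> N \<Longrightarrow> \<exists>y\<in>?M. norm y \<le> 2 * norm x \<and> \<beta> * (norm x)\<^sup>2 \<le> Re (form y x)"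
    by (rule maximal_uniformly_J_positive_pairing[OF M N]) blast
  have "\<exists>C. \<forall>x. cmod (form y x) \<le> C * w x" if "y \<in> ?M" for y
    using that cmod_form_synthesis_le[OF f] by (auto simp: w_def)
  then obtain K where K: "0 < K" "\<And>y x. y \<in> ?M \<Longrightarrow> cmod (form y x) \<le> K * w x * norm y"
    by (rule banach_steinhaus_weighted[OF real_subspace[OF sub]
          maximal_uniformly_J_positive_closed[OF M] bounded_linear_form_left _ w0]) blast+
  \<comment> \<open>Pairing gives \<open>\<beta>\<close>, uniform boundedness gives
    \<open>K\<close>, and the partner \<open>y\<close> has norm at most \<open>2 * norm x\<close>.
    Cancelling one factor \<open>norm x\<close> and squaring yields this constant.\<close>
  define \<gamma> where "\<gamma> = (\<beta> / (2 * K))\<^sup>2"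
  have "\<gamma> * (norm x)\<^sup>2 \<le> Re (form (frame_part A f x) x)" if x: "x \<in> N" for x
  proof -
    obtain y where y: "y \<in> ?M" "norm y \<le> 2 * norm x" "\<beta> * (norm x)\<^sup>2 \<le> Re (form y x)"
      using \<beta>(2)[OF x] by blast
    have "\<beta> * (norm x)\<^sup>2 \<le> cmod (form y x)" using y(3) complex_Re_le_cmod by (rule order_trans)
    also have "\<dots> \<le> K * w x * norm y" by (rule K(2)[OF y(1)])
    also have "\<dots> \<le> K * w x * (2 * norm x)"
      using K(1) w0 y(2) by (intro mult_left_mono) auto
    finally have "(\<beta> * norm x) * norm x \<le> (2 * K * w x) * norm x"
      by (simp add: power2_eq_square mult_ac)
    then have "\<beta> * norm x \<le> 2 * K * w x"
      using K(1) w0[of x] by (cases "x = 0") (auto dest: mult_right_le_imp_le)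
    then have "\<beta> / (2 * K) * norm x \<le> w x" using K(1) by (simp add: field_simps)
    then have "(\<beta> / (2 * K) * norm x)\<^sup>2 \<le> (w x)\<^sup>2"
      using \<beta>(1) K(1) by (intro power_mono) auto
    also have "(w x)\<^sup>2 = Re (form (frame_part A f x) x)"
      by (simp add: form_frame_part_self[OF f] w_def infsum_nonneg)
    finally show ?thesis by (simp add: \<gamma>_def flip: power_mult_distrib)
  qed
  moreover have "0 < \<gamma>" using \<beta>(1) K(1) by (simp add: \<gamma>_def)
  ultimately show thesis using that by blast
qed

text \<open>The frame part defines a coercive symmetric form on \<open>N\<close>, which represents
  the functional given by \<open>y\<close>; testing with \<open>x\<close> itself yields the norm
  estimate.\<close>

lemma frame_part_riesz:
  assumes f: "bessel_family A f" and N: "cvs.subspace N" "closed N"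
    and \<gamma>: "0 < \<gamma>" "\<And>x. x \<in> N \<Longrightarrow> \<gamma> * (norm x)\<^sup>2 \<le> Re (form (frame_part A f x) x)"
  obtains x where "x \<in> N" "\<And>z. z \<in> N \<Longrightarrow> form (frame_part A f x) z = form y z"
    "\<gamma> * norm x \<le> norm y"
proof -
  have sym: "Re (form (frame_part A f u) v) = Re (form (frame_part A f v) u)" for u v
    using frame_part_selfadjoint[OF f, of u v] Re_form_commute by simp
  obtain x where x: "x \<in> N" "\<And>z. z \<in> N \<Longrightarrow> Re (form (frame_part A f x) z) = Re (form y z)"
    by (rule riesz_symmetric_form[OF bounded_bilinear_frame_part[OF f] sym
          real_subspace[OF N(1)] N(2) \<gamma> bounded_linear_Re_form[of y]]) blast+
  have "\<gamma> * (norm x)\<^sup>2 \<le> Re (form y x)" using \<gamma>(2)[OF x(1)] x(2)[OF x(1)] by simp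
  also have "\<dots> \<le> norm y * norm x" using complex_Re_le_cmod cmod_form_le by (rule order_trans)
  finally have "(\<gamma> * norm x) * norm x \<le> norm y * norm x" by (simp add: power2_eq_square mult_ac)
  then have "\<gamma> * norm x \<le> norm y" by (cases "x = 0") (auto dest: mult_right_le_imp_le)
  then show thesis using x form_eqI_Re[OF N(1)] that by blast
qed

text \<open>The Riesz solution satisfies the equation only when tested against \<open>N\<close>. The
  defect lies in the synthesis range, and the pairing lemma with exchanged roles provides a vector
  of \<open>N\<close> that detects it.\<close>

lemma frame_part_surj:
  assumes f: "bessel_family A f"
    and M: "maximal_uniformly_J_positive (synthesis A f ` ell2 A)"
    and N: "maximal_uniformly_J_positive N"
    and y: "y \<in> synthesis A f ` ell2 A"
  obtains x where "x \<in> N" "frame_part A f x = y"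
proof -
  have subM: "cvs.subspace (synthesis A f ` ell2 A)" and subN: "cvs.subspace N"
    using M N by (simp_all add: maximal_uniformly_J_positive_def uniformly_J_positive_def)
  obtain \<gamma> where \<gamma>: "0 < \<gamma>" "\<And>x. x \<in> N \<Longrightarrow> \<gamma> * (norm x)\<^sup>2 \<le> Re (form (frame_part A f x) x)"
    by (rule frame_part_coercive[OF f M N]) blast
  obtain x where x: "x \<in> N" "\<And>z. z \<in> N \<Longrightarrow> form (frame_part A f x) z = form y z"
    by (rule frame_part_riesz[where y = y, OF f subN maximal_uniformly_J_positive_closed[OF N] \<gamma>]) blast+
  define d where "d = frame_part A f x - y"
  have "frame_part A f x \<in> synthesis A f ` ell2 A"
    unfolding frame_part_eq_synthesis using bessel_coefficients_ell2[OF f] by (rule imageI)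
  then have d: "d \<in> synthesis A f ` ell2 A" unfolding d_def using y by (rule cvs.subspace_diff[OF subM])
  obtain \<beta> where \<beta>: "0 < \<beta>"
    "\<And>x. x \<in> synthesis A f ` ell2 A \<Longrightarrow> \<exists>y\<in>N. norm y \<le> 2 * norm x \<and> \<beta> * (norm x)\<^sup>2 \<le> Re (form y x)"
    by (rule maximal_uniformly_J_positive_pairing[OF N M]) blast
  obtain z where z: "z \<in> N" "\<beta> * (norm d)\<^sup>2 \<le> Re (form z d)" using \<beta>(2)[OF d] by blast
  have "form d z = 0" using x(2)[OF z(1)] by (simp add: d_def form_diff_left)
  then have "\<beta> * (norm d)\<^sup>2 \<le> 0" using z(2) Re_form_commute[of z d] by simp
  then have "d = 0" using \<beta>(1) by (simp add: mult_le_0_iff)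
  then show thesis using x(1) by (intro that) (simp_all add: d_def)
qed

text \<open>Selfadjointness moves the frame part from \<open>x\<close> to \<open>g i\<close>, so the
  coefficients of \<open>y\<close> against \<open>g\<close> are those of the Riesz solution
  \<open>x\<close> against \<open>f\<close>. The range is all of \<open>N\<close> by the
  reconstruction of \<open>x\<close> from its coefficients \<open>form x (f i)\<close> along
  \<open>g\<close>.\<close>

lemma bessel_family_frame_part_preimage:
  assumes f: "bessel_family A f"
    and M: "maximal_uniformly_J_positive (synthesis A f ` ell2 A)"
    and N: "maximal_uniformly_J_positive N"
    and g: "\<And>i. i \<in> A \<Longrightarrow> g i \<in> N" "\<And>i. i \<in> A \<Longrightarrow> frame_part A f (g i) = f i"
  shows "bessel_family A g" and "synthesis A g ` ell2 A = N"
proof -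
  have subN: "cvs.subspace N"
    using N by (simp add: maximal_uniformly_J_positive_def uniformly_J_positive_def)
  have clN: "closed N" by (rule maximal_uniformly_J_positive_closed[OF N])
  obtain \<gamma> where \<gamma>: "0 < \<gamma>" "\<And>x. x \<in> N \<Longrightarrow> \<gamma> * (norm x)\<^sup>2 \<le> Re (form (frame_part A f x) x)"
    by (rule frame_part_coercive[OF f M N]) blast
  obtain B where B: "\<And>x. (\<lambda>i. (cmod (form x (f i)))\<^sup>2) summable_on A"
    "\<And>x. (\<Sum>\<^sub>\<infinity>i\<in>A. (cmod (form x (f i)))\<^sup>2) \<le> B * (norm x)\<^sup>2"
    using f unfolding bessel_family_form_iff by blast
  have "(\<lambda>i. (cmod (form y (g i)))\<^sup>2) summable_on A \<and>
      (\<Sum>\<^sub>\<infinity>i\<in>A. (cmod (form y (g i)))\<^sup>2) \<le> \<bar>B\<bar> / \<gamma>\<^sup>2 * (norm y)\<^sup>2" for y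
  proof -
    obtain x where x: "x \<in> N" "\<And>z. z \<in> N \<Longrightarrow> form (frame_part A f x) z = form y z"
      "\<gamma> * norm x \<le> norm y"
      by (rule frame_part_riesz[where y = y, OF f subN clN \<gamma>]) blast+
    have eq: "form y (g i) = form x (f i)" if "i \<in> A" for i
      using x(2)[OF g(1)[OF that]] frame_part_selfadjoint[OF f, of x "g i"] g(2)[OF that] by simp
    have "(\<Sum>\<^sub>\<infinity>i\<in>A. (cmod (form y (g i)))\<^sup>2) = (\<Sum>\<^sub>\<infinity>i\<in>A. (cmod (form x (f i)))\<^sup>2)"
      by (rule infsum_cong) (simp add: eq)
    also have "\<dots> \<le> B * (norm x)\<^sup>2" by (rule B)
    also have "\<dots> \<le> \<bar>B\<bar> * (norm x)\<^sup>2" by (intro mult_right_mono) auto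
    also have "\<dots> \<le> \<bar>B\<bar> * (norm y / \<gamma>)\<^sup>2"
      using x(3) \<gamma>(1) by (intro mult_left_mono power_mono) (auto simp: field_simps)
    finally have "(\<Sum>\<^sub>\<infinity>i\<in>A. (cmod (form y (g i)))\<^sup>2) \<le> \<bar>B\<bar> / \<gamma>\<^sup>2 * (norm y)\<^sup>2"
      by (simp add: power_divide)
    moreover have "(\<lambda>i. (cmod (form y (g i)))\<^sup>2) summable_on A"
      using B(1)[of x] by (rule summable_on_cong[THEN iffD1, rotated]) (simp add: eq)
    ultimately show ?thesis by blast
  qed
  then show bg: "bessel_family A g" unfolding bessel_family_form_iff by blast
  have has_sum: "((\<lambda>i. c i *\<^sub>C g i) has_sum synthesis A g c) A" if "c \<in> ell2 A" for c
    unfolding synthesis_def by (rule has_sum_infsum[OF synthesis_summable[OF bg that]])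
  have mem: "synthesis A g c \<in> N" if c: "c \<in> ell2 A" for c
  proof (rule Lim_in_closed_set[OF clN])
    show "(sum (\<lambda>i. c i *\<^sub>C g i) \<longlongrightarrow> synthesis A g c) (finite_subsets_at_top A)"
      using has_sum[OF c] unfolding has_sum_def .
    show "\<forall>\<^sub>F F in finite_subsets_at_top A. (\<Sum>i\<in>F. c i *\<^sub>C g i) \<in> N"
      by (rule eventually_finite_subsets_at_top_weakI)
        (use g(1) in \<open>auto intro!: cvs.subspace_sum[OF subN] cvs.subspace_scale[OF subN]\<close>)
  qed simp
  moreover have "x \<in> synthesis A g ` ell2 A" if x: "x \<in> N" for x
  proof -
    define c where "c i = (if i \<in> A then form x (f i) else 0)" for i
    have c: "c \<in> ell2 A" unfolding c_def by (rule bessel_coefficients_ell2[OF f])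
    interpret S: bounded_linear "frame_part A f" by (rule bounded_linear_frame_part[OF f])
    have "((\<lambda>i. frame_part A f (c i *\<^sub>C g i)) has_sum frame_part A f (synthesis A g c)) A"
      by (rule has_sum_bounded_linear[OF S.bounded_linear_axioms has_sum[OF c]])
    then have "((\<lambda>i. form x (f i) *\<^sub>C f i) has_sum frame_part A f (synthesis A g c)) A"
      by (rule has_sum_cong[THEN iffD1, rotated]) (simp add: c_def frame_part_scale[OF f] g(2))
    \<comment> \<open>\<open>x\<close> and its reconstruction have the same image, and coercivity
      makes the frame part injective on \<open>N\<close>.\<close>
    then have "frame_part A f (x - synthesis A g c) = 0"
      using has_sum_unique[OF frame_part_has_sum[OF f]] by (simp add: S.diff)
    moreover have "x - synthesis A g c \<in> N" by (intro cvs.subspace_diff[OF subN] x mem c)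
    ultimately have "\<gamma> * (norm (x - synthesis A g c))\<^sup>2 \<le> 0" using \<gamma>(2) by fastforce
    then have "x = synthesis A g c" using \<gamma>(1) by (simp add: mult_le_0_iff)
    then show ?thesis using c by blast
  qed
  ultimately show "synthesis A g ` ell2 A = N" by blast
qed

section \<open>Transfer of the frame part results to negative subspaces\<close>

lemma dual_bessel_family: "krein_space.bessel_family (\<lambda>x y. - form x y) Hm Hp I f \<longleftrightarrow> bessel_family I f"
proof -
  interpret dual: krein_space scale "\<lambda>x y. - form x y" Hm Hp by (rule krein_space_dual)
  show ?thesis by (simp add: dual.bessel_family_def bessel_family_def dual_ip)
qed

lemma dual_frame_part:
  "krein_space.frame_part scale (\<lambda>x y. - form x y) A f x = - frame_part A f x"
proof -
  interpret dual: krein_space scale "\<lambda>x y. - form x y" Hm Hp by (rule krein_space_dual)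
  show ?thesis
    unfolding dual.frame_part_def cvs.scale_minus_left frame_part_def by (rule infsum_uminus)
qed

lemma maximal_uniformly_J_negative_J_orth:
  assumes "maximal_uniformly_J_positive M"
  shows "maximal_uniformly_J_negative (J_orth M)"
proof -
  interpret dual: krein_space scale "\<lambda>x y. - form x y" Hm Hp by (rule krein_space_dual)
  have "dual.maximal_uniformly_J_negative M"
    using assms by (simp add: dual.maximal_uniformly_J_negative_def dual.uniformly_J_negative_def
        maximal_uniformly_J_positive_def uniformly_J_positive_def)
  then show ?thesis
    using dual.maximal_uniformly_J_positive_J_orth
    by (simp add: dual_maximal_uniformly_J_positive dual_J_orth)
qed

text \<open>Negating the form negates the frame part; this is also the sign with which the negative
  half enters the J-frame operator.\<close>

lemma frame_part_surj_negative:
  assumes "bessel_family A f"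
    and "maximal_uniformly_J_negative (synthesis A f ` ell2 A)"
    and "maximal_uniformly_J_negative N"
    and "y \<in> synthesis A f ` ell2 A"
  obtains x where "x \<in> N" "- frame_part A f x = y"
proof -
  interpret dual: krein_space scale "\<lambda>x y. - form x y" Hm Hp by (rule krein_space_dual)
  show thesis
    using dual.frame_part_surj[of A f N y] assms that
    by (auto simp: dual_bessel_family dual_maximal_uniformly_J_positive dual_frame_part)
qed

lemma bessel_family_frame_part_preimage_negative:
  assumes "bessel_family A f"
    and "maximal_uniformly_J_negative (synthesis A f ` ell2 A)"
    and "maximal_uniformly_J_negative N"
    and "\<And>i. i \<in> A \<Longrightarrow> g i \<in> N" "\<And>i. i \<in> A \<Longrightarrow> - frame_part A f (g i) = f i"
  shows "bessel_family A g" and "synthesis A g ` ell2 A = N"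
proof -
  interpret dual: krein_space scale "\<lambda>x y. - form x y" Hm Hp by (rule krein_space_dual)
  show "bessel_family A g" "synthesis A g ` ell2 A = N"
    using dual.bessel_family_frame_part_preimage[of A f N g] assms
    by (auto simp: dual_bessel_family dual_maximal_uniformly_J_positive dual_frame_part)
qed

section \<open>Splitting the J-frame operator and assembling the inverse family\<close>

text \<open>Coefficients outside \<open>A\<close> contribute nothing, so the ranges in the
  definition of a J-frame are synthesis ranges of subfamilies.\<close>

lemma synthesis_ell2_proj_image:
  assumes "A \<subseteq> I"
  shows "(synthesis I f \<circ> ell2_proj A) ` ell2 I = synthesis A f ` ell2 A"
proof -
  have eq: "synthesis I f (ell2_proj A c) = synthesis A f (ell2_proj A c)" for c
    unfolding synthesis_def by (rule infsum_cong_neutral) (use assms in \<open>auto simp: ell2_proj_def\<close>)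
  have "ell2_proj A ` ell2 I = ell2 A"
  proof (intro subset_antisym subsetI)
    fix d assume "d \<in> ell2_proj A ` ell2 I"
    then obtain c where c: "d = ell2_proj A c" "(\<lambda>i. (cmod (c i))\<^sup>2) summable_on I"
      by (auto simp: ell2_def)
    have "(\<lambda>i. (cmod (c i))\<^sup>2) summable_on A" by (rule summable_on_subset_banach[OF c(2) assms])
    then have "(\<lambda>i. (cmod (d i))\<^sup>2) summable_on A"
      by (rule summable_on_cong[THEN iffD1, rotated]) (simp add: c(1) ell2_proj_def)
    then show "d \<in> ell2 A" by (simp add: ell2_def c(1) ell2_proj_def)
  next
    fix d assume d: "d \<in> ell2 A"
    then have "(\<lambda>i. (cmod (d i))\<^sup>2) summable_on I \<longleftrightarrow> (\<lambda>i. (cmod (d i))\<^sup>2) summable_on A"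
      using assms by (intro summable_on_cong_neutral) (auto simp: ell2_def)
    then have "d \<in> ell2 I" using d assms by (auto simp: ell2_def)
    moreover have "d = ell2_proj A d" using d by (auto simp: ell2_def ell2_proj_def fun_eq_iff)
    ultimately show "d \<in> ell2_proj A ` ell2 I" by blast
  qed
  then show ?thesis by (metis (no_types, lifting) comp_apply eq image_cong image_image)
qed

lemma family_in_synthesis_range:
  assumes "i \<in> A"
  shows "f i \<in> synthesis A f ` ell2 A"
proof -
  have "(\<lambda>j. (cmod (if j = i then 1 else 0))\<^sup>2) summable_on A \<longleftrightarrow> (\<lambda>j. (1::real)) summable_on {i}"
    using assms by (intro summable_on_cong_neutral) auto
  then have "(\<lambda>j. if j = i then 1 else 0) \<in> ell2 A" using assms by (auto simp: ell2_def)
  then show ?thesis using synthesis_basis[OF assms, of f] by (metis image_eqI)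
qed

text \<open>Vanishing analysis coefficients make the Cauchy-Schwarz bound zero for every synthesised
  vector.\<close>

lemma J_orth_synthesis_range:
  assumes f: "bessel_family A f" and x: "\<And>i. i \<in> A \<Longrightarrow> form x (f i) = 0"
  shows "x \<in> J_orth (synthesis A f ` ell2 A)"
proof -
  have "form (synthesis A f c) x = 0" if c: "c \<in> ell2 A" for c
  proof -
    have "(\<Sum>\<^sub>\<infinity>i\<in>A. (cmod (form x (f i)))\<^sup>2) = 0" by (rule infsum_0) (simp add: x)
    then show ?thesis using cmod_form_synthesis_le[OF f c, of x] by simp
  qed
  then show ?thesis unfolding J_orth_def by (auto simp: form_hermitian[of x])
qed

text \<open>Since \<open>sgn 0 = 0\<close>, isotropic members drop out of the J-frame operator but
  not out of \<open>index_plus\<close>; the assumption \<open>pos\<close> makes them zero vectors,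
  so both sides agree.\<close>

lemma J_frame_operator_eq:
  assumes f: "bessel_family I f"
    and pos: "\<And>i. i \<in> index_plus I f \<Longrightarrow> Re (form (f i) (f i)) = 0 \<Longrightarrow> f i = 0"
  shows "J_frame_operator I f x
    = frame_part (index_plus I f) f x - frame_part (index_minus I f) f x"
proof -
  let ?g = "\<lambda>i. (complex_of_real (sgn (Re (form (f i) (f i)))) * form x (f i)) *\<^sub>C f i"
  have split: "I = index_plus I f \<union> index_minus I f" "index_plus I f \<inter> index_minus I f = {}"
    by (auto simp: index_plus_def index_minus_def)
  have b: "bessel_family (index_plus I f) f" "bessel_family (index_minus I f) f"
    by (rule bessel_family_subset[OF f]; force simp: index_plus_def index_minus_def)+
  have "(?g has_sum frame_part (index_plus I f) f x) (index_plus I f)"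
    using frame_part_has_sum[OF b(1)]
  proof (rule has_sum_cong[THEN iffD1, rotated])
    fix i assume i: "i \<in> index_plus I f"
    show "form x (f i) *\<^sub>C f i = ?g i"
    proof (cases "Re (form (f i) (f i)) = 0")
      case True
      then show ?thesis using pos[OF i] by simp
    next
      case False
      then have "0 < Re (form (f i) (f i))" using i by (simp add: index_plus_def)
      then show ?thesis by simp
    qed
  qed
  moreover have "(?g has_sum - frame_part (index_minus I f) f x) (index_minus I f)"
    using has_sum_bounded_linear[OF bounded_linear_minus[OF bounded_linear_ident]
        frame_part_has_sum[OF b(2)]]
    by (rule has_sum_cong[THEN iffD1, rotated]) (simp add: index_minus_def)
  ultimately have "(?g has_sum (frame_part (index_plus I f) f x + - frame_part (index_minus I f) f x)) I"
    using split by (metis has_sum_Un_disjoint)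
  then show ?thesis unfolding J_frame_operator_def using infsumI by fastforce
qed

lemma uniformly_J_positive_form_pos:
  assumes "uniformly_J_positive M" "x \<in> M" "x \<noteq> 0"
  shows "0 < Re (form x x)"
proof -
  obtain \<alpha> where "0 < \<alpha>" "\<alpha> * (norm x)\<^sup>2 \<le> Re (form x x)"
    using assms unfolding uniformly_J_positive_def by blast
  moreover have "0 < \<alpha> * (norm x)\<^sup>2" using \<open>0 < \<alpha>\<close> assms(3) by simp
  ultimately show ?thesis by linarith
qed

lemma uniformly_J_negative_form_neg:
  assumes "uniformly_J_negative M" "x \<in> M" "x \<noteq> 0"
  shows "Re (form x x) < 0"
proof -
  obtain \<alpha> where "0 < \<alpha>" "Re (form x x) \<le> - \<alpha> * (norm x)\<^sup>2"
    using assms unfolding uniformly_J_negative_def by blast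
  moreover have "0 < \<alpha> * (norm x)\<^sup>2" using \<open>0 < \<alpha>\<close> assms(3) by simp
  ultimately show ?thesis by simp
qed

lemma J_frame_inverse:
  assumes "J_frame I f"
  shows "J_frame I (\<lambda>i. inv (J_frame_operator I f) (f i))"
proof -
  define P Q where "P = index_plus I f" and "Q = index_minus I f"
  define S where "S = J_frame_operator I f"
  define Mp where "Mp = synthesis P f ` ell2 P"
  define Mq where "Mq = synthesis Q f ` ell2 Q"
  have sub: "P \<subseteq> I" "Q \<subseteq> I" and un: "P \<union> Q = I" and disj: "P \<inter> Q = {}"
    by (auto simp: P_def Q_def index_plus_def index_minus_def)
  have f: "bessel_family I f" using assms by (simp add: J_frame_def)
  have fP: "bessel_family P f" and fQ: "bessel_family Q f"
    using bessel_family_subset[OF f] sub by blast+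
  have Mp: "maximal_uniformly_J_positive Mp" and Mq: "maximal_uniformly_J_negative Mq"
    using assms synthesis_ell2_proj_image[OF sub(1), of f] synthesis_ell2_proj_image[OF sub(2), of f]
    by (simp_all add: J_frame_def synthesis_plus_def synthesis_minus_def P_def Q_def Mp_def Mq_def)
  define Np where "Np = J_orth Mq"
  define Nq where "Nq = J_orth Mp"
  have Np: "maximal_uniformly_J_positive Np" and Nq: "maximal_uniformly_J_negative Nq"
    unfolding Np_def Nq_def
    by (rule maximal_uniformly_J_positive_J_orth[OF Mq] maximal_uniformly_J_negative_J_orth[OF Mp])+
  have uMp: "uniformly_J_positive Mp" and uMq: "uniformly_J_negative Mq"
    and uNp: "uniformly_J_positive Np" and uNq: "uniformly_J_negative Nq"
    using Mp Mq Np Nq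
    by (simp_all add: maximal_uniformly_J_positive_def maximal_uniformly_J_negative_def)
  have fMp: "f i \<in> Mp" if "i \<in> P" for i unfolding Mp_def by (rule family_in_synthesis_range[OF that])
  have fMq: "f i \<in> Mq" if "i \<in> Q" for i unfolding Mq_def by (rule family_in_synthesis_range[OF that])
  have S_eq: "S x = frame_part P f x - frame_part Q f x" for x
    unfolding S_def P_def Q_def
  proof (rule J_frame_operator_eq[OF f])
    fix i assume "i \<in> index_plus I f" "Re (form (f i) (f i)) = 0"
    then show "f i = 0" using uniformly_J_positive_form_pos[OF uMp fMp[of i]] by (force simp: P_def)
  qed
  interpret SP: bounded_linear "frame_part P f" by (rule bounded_linear_frame_part[OF fP])
  interpret SQ: bounded_linear "frame_part Q f" by (rule bounded_linear_frame_part[OF fQ])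
  have no_isotropic: "x = 0"
    if "x \<in> A" "x \<in> B" "uniformly_J_positive A" "uniformly_J_negative B" for x A B
    using uniformly_J_positive_form_pos[of A x] uniformly_J_negative_form_neg[of B x] that by force
  \<comment> \<open>The two halves of \<open>S x\<close> lie in subspaces of opposite sign, so both
    vanish. Then all coefficients of \<open>x\<close> vanish, and \<open>x\<close> belongs to both
    companions, which again have opposite sign.\<close>
  have ker: "x = 0" if x: "S x = 0" for x
  proof -
    have "frame_part P f x \<in> Mp" "frame_part Q f x \<in> Mq"
      unfolding Mp_def Mq_def frame_part_eq_synthesis
      using bessel_coefficients_ell2[OF fP] bessel_coefficients_ell2[OF fQ] by blast+
    then have 0: "frame_part P f x = 0" "frame_part Q f x = 0"
      using x no_isotropic[OF _ _ uMp uMq] by (simp_all add: S_eq)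
    have "form x (f i) = 0" if "i \<in> A" "bessel_family A f" "frame_part A f x = 0" for i A
    proof -
      have "(\<Sum>\<^sub>\<infinity>i\<in>A. (cmod (form x (f i)))\<^sup>2) = 0"
        using form_frame_part_self[OF that(2), of x] that(3) by simp
      moreover have "(\<lambda>i. (cmod (form x (f i)))\<^sup>2) summable_on A"
        using that(2) unfolding bessel_family_form_iff by blast
      ultimately have "(cmod (form x (f i)))\<^sup>2 = 0"
        by (intro nonneg_infsum_le_0D[OF _ _ _ that(1)]) auto
      then show ?thesis by simp
    qed
    then have "x \<in> Nq" "x \<in> Np"
      unfolding Np_def Nq_def Mp_def Mq_def
      using 0 fP fQ by (blast intro: J_orth_synthesis_range)+
    then show "x = 0" using no_isotropic uNp uNq by blast
  qed
  have inj: "inj S"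
  proof (rule injI)
    fix x y assume "S x = S y"
    then have "S (x - y) = 0" by (simp add: S_eq SP.diff SQ.diff algebra_simps)
    then show "x = y" using ker[of "x - y"] by simp
  qed
  \<comment> \<open>On each companion one half of the operator disappears, so \<open>S\<close>
    reduces there to a single signed frame part.\<close>
  have Q0: "frame_part Q f x = 0" if "x \<in> Np" for x
    unfolding frame_part_def using that fMq by (intro infsum_0) (auto simp: Np_def J_orth_def)
  have P0: "frame_part P f x = 0" if "x \<in> Nq" for x
    unfolding frame_part_def using that fMp by (intro infsum_0) (auto simp: Nq_def J_orth_def)
  define g where "g i = inv S (f i)" for i
  have gP: "g i \<in> Np" "frame_part P f (g i) = f i" if i: "i \<in> P" for i
  proof -
    obtain x where x: "x \<in> Np" "frame_part P f x = f i"
      using frame_part_surj[OF fP Mp[unfolded Mp_def] Np fMp[OF i, unfolded Mp_def]] by blast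
    then have "S x = f i" by (simp add: S_eq Q0)
    \<comment> \<open>Injectivity identifies \<open>inv S (f i)\<close> with the preimage found in
      \<open>Np\<close>.\<close>
    then have "g i = x" using inj by (metis g_def inv_f_f)
    then show "g i \<in> Np" "frame_part P f (g i) = f i" using x by simp_all
  qed
  have gQ: "g i \<in> Nq" "- frame_part Q f (g i) = f i" if i: "i \<in> Q" for i
  proof -
    obtain x where x: "x \<in> Nq" "- frame_part Q f x = f i"
      using frame_part_surj_negative[OF fQ Mq[unfolded Mq_def] Nq fMq[OF i, unfolded Mq_def]] by blast
    then have "S x = f i" by (simp add: S_eq P0)
    then have "g i = x" using inj by (metis g_def inv_f_f)
    then show "g i \<in> Nq" "- frame_part Q f (g i) = f i" using x by simp_all
  qed
  note P = bessel_family_frame_part_preimage[OF fP Mp[unfolded Mp_def] Np gP]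
  note Q = bessel_family_frame_part_preimage_negative[OF fQ Mq[unfolded Mq_def] Nq gQ]
  have signP: "0 \<le> Re (form (g i) (g i))" if "i \<in> P" for i
    using uniformly_J_positive_form_pos[OF uNp gP(1)[OF that]] by (cases "g i = 0") auto
  have signQ: "Re (form (g i) (g i)) < 0" if i: "i \<in> Q" for i
  proof (rule uniformly_J_negative_form_neg[OF uNq gQ(1)[OF i]])
    \<comment> \<open>Strict negativity needs a nonzero vector: a member of negative square is
      nonzero, hence so is its preimage.\<close>
    have "f i \<noteq> 0" using i by (auto simp: Q_def index_minus_def)
    then show "g i \<noteq> 0" using gQ(2)[OF i] SQ.zero by auto
  qed
  \<comment> \<open>As \<open>P\<close> and \<open>Q\<close> exhaust the index set and the signs
    persist, the new family induces the same partition.\<close>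
  have "index_plus I g = P" "index_minus I g = Q"
    unfolding index_plus_def index_minus_def using un signP signQ by force+
  then have "J_frame I g"
    unfolding J_frame_def synthesis_plus_def synthesis_minus_def
    using bessel_family_Un[OF P(1) Q(1) disj] Np Nq
    by (simp add: un synthesis_ell2_proj_image sub P(2) Q(2) del: comp_apply)
  then show ?thesis by (simp add: g_def[abs_def] S_def)
qed

end

theorem proposition5p3:
  fixes scale :: "complex \<Rightarrow> 'a::banach \<Rightarrow> 'a"
    and form :: "'a \<Rightarrow> 'a \<Rightarrow> complex"
    and Hp Hm :: "'a set"
    and I :: "'i set"
    and f :: "'i \<Rightarrow> 'a"
    and S :: "'a \<Rightarrow> 'a"
  assumes "krein_space scale form Hp Hm"
    and "krein_space.J_frame scale form Hp Hm I f"
    and "S = krein_space.J_frame_operator scale form I f"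
  shows "krein_space.J_frame scale form Hp Hm I (\<lambda>i. inv S (f i))"
  unfolding assms(3) using assms(1,2) by (rule krein_space.J_frame_inverse)

end
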